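(* Let $h_1(n)$ be defined by $$(-q^{2},-q^{3};q^{5})_{\infty}^{2}(q^{2},q^{8};q^{10})_{\infty}=\sum_{n=0}^{\infty}h_{1}(n)q^{n}.$$ Then for any integer $n\geq0$: $h_{1}(5n)>0$; $h_{1}(5n+2)>0$ provided $n\neq1$; $h_{1}(5n+3)>0$; and $h_{1}(5n+4)<0$ provided $n\neq1$.
   Context: Notation: for $|q|<1$, $(a;q)_{\infty}:=\prod_{n=0}^{\infty}(1-aq^{n})$ and $(a_{1},\ldots,a_{m};q)_{\infty}:=(a_{1};q)_{\infty}\cdots(a_{m};q)_{\infty}$; similarly with $q$ replaced by $q^k$ in the base. *)

theory Defs
  imports "HOL-Complex_Analysis.Complex_Analysis"
begin

text \<open>The q-shifted factorials (a; q) and (a1, ..., am; q) of infinite order, meaningful for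
  q in the open unit disc.\<close>

definition qpoch_inf :: "complex \<Rightarrow> complex \<Rightarrow> complex" where
  "qpoch_inf a q = (\<Prod>n. 1 - a * q ^ n)"

definition qpochs_inf :: "complex list \<Rightarrow> complex \<Rightarrow> complex" where
  "qpochs_inf as q = (\<Prod>a\<leftarrow>as. qpoch_inf a q)"


definition h1_gf :: "complex \<Rightarrow> complex" where
  "h1_gf q = (qpochs_inf [- (q ^ 2), - (q ^ 3)] (q ^ 5)) ^ 2 * qpochs_inf [q ^ 2, q ^ 8] (q ^ 10)"

lemma qpoch_lim:
  assumes q: "norm q < 1"
  shows "(\<lambda>n. \<Prod>i<n. 1 - a * q ^ i) \<longlonglongrightarrow> qpoch_inf a q"
proof -
  have "summable (\<lambda>i. norm ((1 - a * q ^ i) - 1))"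
    using q by (auto simp: norm_mult norm_power intro!: summable_mult summable_geometric)
  hence "abs_convergent_prod (\<lambda>i. 1 - a * q ^ i)"
    by (rule summable_imp_abs_convergent_prod)
  hence "convergent_prod (\<lambda>i. 1 - a * q ^ i)"
    by (rule abs_convergent_prod_imp_convergent_prod)
  hence "(\<lambda>n. \<Prod>i\<le>n. 1 - a * q ^ i) \<longlonglongrightarrow> qpoch_inf a q"
    unfolding qpoch_inf_def by (rule convergent_prod_LIMSEQ)
  thus ?thesis by (subst (asm) LIMSEQ_lessThan_iff_atMost [symmetric]) 
qed

lemma qpoch_cnj:
  assumes q: "norm q < 1"
  shows "qpoch_inf (cnj a) (cnj q) = cnj (qpoch_inf a q)"
proof -
  have "(\<lambda>n. cnj (\<Prod>i<n. 1 - a * q ^ i)) \<longlonglongrightarrow> cnj (qpoch_inf a q)"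
    by (intro tendsto_cnj qpoch_lim q)
  moreover have "(\<lambda>n. \<Prod>i<n. 1 - cnj a * cnj q ^ i) \<longlonglongrightarrow> qpoch_inf (cnj a) (cnj q)"
    by (rule qpoch_lim) (use q in simp)
  ultimately show ?thesis by (simp add: LIMSEQ_unique)
qed

lemma qpoch_holo:
  assumes c: "norm c = 1" and k: "k > 0"
  shows "(\<lambda>q. qpoch_inf (c * q ^ m) (q ^ k)) holomorphic_on ball 0 1"
proof (rule holomorphic_uniform_sequence[where f = "\<lambda>n q. \<Prod>i<n. 1 - (c * q ^ m) * (q ^ k) ^ i"])
  fix x :: complex assume x: "x \<in> ball 0 1"
  define d where "d = (1 - norm x) / 2"
  have d: "d > 0" using x by (simp add: d_def)
  have sub: "norm y \<le> (1 + norm x) / 2" if "y \<in> cball x d" for y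
    using that norm_triangle_ineq[of x "y - x"] by (simp add: d_def dist_norm norm_minus_commute)
  define r where "r = (1 + norm x) / 2"
  have r: "0 \<le> r" "r < 1" using x by (auto simp: r_def)
  have "uniformly_convergent_on (cball x d) (\<lambda>n q. \<Prod>i<n. 1 - (c * q ^ m) * (q ^ k) ^ i)"
  proof (rule uniformly_convergent_on_prod')
    show "uniformly_convergent_on (cball x d) (\<lambda>N q. \<Sum>n<N. norm (1 - (c * q ^ m) * (q ^ k) ^ n - 1))"
    proof (rule Weierstrass_m_test')
      fix n y assume "y \<in> cball x d"
      hence y: "norm y \<le> r" using sub by (simp add: r_def)
      have "norm (c * y ^ m * (y ^ k) ^ n) = norm y ^ m * (norm y ^ k) ^ n"
        by (simp add: norm_mult norm_power c)
      also have "\<dots> \<le> 1 * (r ^ 1) ^ n"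
      proof (intro mult_mono power_mono)
        show "norm y ^ m \<le> 1" using y r by (intro power_le_one) auto
        have "norm y ^ k \<le> r ^ k" using y by (intro power_mono) auto
        also have "\<dots> \<le> r ^ 1" using r k by (intro power_decreasing) auto
        finally show "norm y ^ k \<le> r ^ 1" .
      qed (use r in auto)
      finally show "norm (norm (1 - c * y ^ m * (y ^ k) ^ n - 1)) \<le> r ^ n" by simp
    qed (use r in auto)
  qed (auto intro!: continuous_intros)
  then obtain g where g: "uniform_limit (cball x d) (\<lambda>n q. \<Prod>i<n. 1 - (c * q ^ m) * (q ^ k) ^ i) g sequentially"
    by (auto simp: uniformly_convergent_on_def)
  have ball: "cball x d \<subseteq> ball 0 1" using sub r by (fastforce simp: r_def)
  have "g y = qpoch_inf (c * y ^ m) (y ^ k)" if y: "y \<in> cball x d" for y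
  proof -
    have "norm (y ^ k) < 1"
      using y ball k by (auto simp: norm_power power_less_one_iff)
    from qpoch_lim[OF this] tendsto_uniform_limitI[OF g y] show ?thesis
      using LIMSEQ_unique by blast
  qed
  hence "uniform_limit (cball x d) (\<lambda>n q. \<Prod>i<n. 1 - (c * q ^ m) * (q ^ k) ^ i)
     (\<lambda>y. qpoch_inf (c * y ^ m) (y ^ k)) sequentially"
    using g by (subst uniform_limit_cong'[where h = _ and i = g]) (auto)
  thus "\<exists>d>0. cball x d \<subseteq> ball 0 1 \<and> uniform_limit (cball x d) (\<lambda>n q. \<Prod>i<n. 1 - (c * q ^ m) * (q ^ k) ^ i)
     (\<lambda>y. qpoch_inf (c * y ^ m) (y ^ k)) sequentially"
    using d ball by blast
qed (auto intro!: holomorphic_intros)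

lemma h1_gf_holo: "h1_gf holomorphic_on ball 0 1"
  using qpoch_holo[of "-1" 5 2] qpoch_holo[of "-1" 5 3] qpoch_holo[of 1 10 2] qpoch_holo[of 1 10 8]
  unfolding h1_gf_def[abs_def] qpochs_inf_def
  by (auto intro!: holomorphic_intros)

lemma h1_gf_cnj: assumes "norm q < 1" shows "h1_gf (cnj q) = cnj (h1_gf q)"
proof -
  have q: "norm (q ^ 5) < 1" "norm (q ^ 10) < 1"
    using assms by (auto simp: norm_power power_less_one_iff)
  show ?thesis
    using qpoch_cnj[OF q(1), of "-(q^2)"] qpoch_cnj[OF q(1), of "-(q^3)"] 
       qpoch_cnj[OF q(2), of "q^2"] qpoch_cnj[OF q(2), of "q^8"]
    by (simp add: h1_gf_def qpochs_inf_def)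
qed

text \<open>The coefficient sequence of the product exists (and by uniqueness of power series is unique),
  so it may be introduced as a sequence satisfying the expansion on the whole unit disc.\<close>

lemma h1_exists:
  "\<exists>h1 :: nat \<Rightarrow> real. \<forall>q :: complex. norm q < 1 \<longrightarrow> 
      (\<lambda>n. of_real (h1 n) * q ^ n) sums
        ((qpochs_inf [- (q ^ 2), - (q ^ 3)] (q ^ 5)) ^ 2 * qpochs_inf [q ^ 2, q ^ 8] (q ^ 10))"
proof (intro exI allI impI)
  define a where "a = (\<lambda>n. (deriv ^^ n) h1_gf 0 / fact n)"
  fix q :: complex assume q: "norm q < 1"
  have *: "(\<lambda>n. a n * w ^ n) sums h1_gf w" if "norm w < 1" for w
    using holomorphic_power_series[OF h1_gf_holo, of w] that by (simp add: a_def)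
  have "(\<lambda>n. cnj (a n * cnj q ^ n)) sums cnj (h1_gf (cnj q))"
    using *[of "cnj q"] q by (simp only: sums_cnj) simp
  hence "(\<lambda>n. cnj (a n) * q ^ n) sums h1_gf q"
    using h1_gf_cnj[of q] q by simp
  from sums_mult[OF sums_add[OF *[OF q] this], of "1/2"]
  have "(\<lambda>n. (a n + cnj (a n)) / 2 * q ^ n) sums h1_gf q"
    by (simp add: algebra_simps add_divide_distrib)
  thus "(\<lambda>n. of_real (Re (a n)) * q ^ n) sums ((qpochs_inf [- (q ^ 2), - (q ^ 3)] (q ^ 5)) ^ 2 * qpochs_inf [q ^ 2, q ^ 8] (q ^ 10))"
    by (simp add: h1_gf_def complex_add_cnj)
qed
end

theory Submission
  imports Defs
begin

text \<open>
  Put \<open>Q = q\<^sup>5\<close>. Multiplied by a suitable product of shifted factorials in \<open>Q\<close>, the generating function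
  is \<open>theta(w; Q)\<^sup>2 theta(-w; Q\<^sup>2)\<close> at \<open>w = q\<^sup>2\<close>, where \<open>theta(z; p) = \<Sum> z\<^sup>n p\<^bsup>n(n-1)/2\<^esup>\<close>. As a function of
  \<open>w\<close> this is quasi-periodic of degree 5, so its Laurent coefficients in one residue class modulo 5
  form, up to one constant per class, a single theta series in \<open>w\<^sup>5\<close>. Setting \<open>w = q\<^sup>2\<close> then turns
  the five classes of exponents of \<open>w\<close> into the five classes of exponents of \<open>q\<close>.

  The five constants are power series in \<open>Q\<close>, and the point is that they are products. The symmetry
  \<open>w \<mapsto> 1/w\<close> leaves three of them, the classes 0, 1 and 4. The constant of class 4 is a binary theta series for
  \<open>a\<^sup>2 + 5 b\<^sup>2\<close>, and multiplication by \<open>1 + \<surd>-5\<close> identifies it with \<open>-2 Q (Q; Q) (Q\<^sup>5; Q\<^sup>5)\<close>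
  (\<open>quint_coeff_4\<close>). The other two belong to a different
  quadratic field than the products they equal, so no linear change of summation variables can evaluate
  them; instead, the zeros of \<open>theta(w; Q)\<close> at \<open>w = -1\<close> and \<open>w = -Q\<close> give two linear
  equations, whose coefficients are exactly those occurring in the two-term splittings of
  \<open>theta(-Q\<^sup>2; Q\<^sup>5)\<^sup>2\<close>, \<open>theta(-Q; Q\<^sup>5)\<^sup>2\<close> and \<open>theta(-Q\<^sup>2; Q\<^sup>5) theta(-Q; Q\<^sup>5)\<close>. Cramer's rule then
  yields the first two of these as the constants (\<open>quint_coeff_0_1\<close>).

  With the Jacobi triple product and the Rogers-Ramanujan products \<open>G(x) = 1/(x, x\<^sup>4; x\<^sup>5)\<close> and
  \<open>H(x) = 1/(x\<^sup>2, x\<^sup>3; x\<^sup>5)\<close> the outcome is (\<open>h1_gf_dissection\<close>)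
  \<open>G(Q)\<^sup>2 G(Q\<^sup>2) + q\<^sup>2 H(Q)\<^sup>2 G(Q\<^sup>2) + 2 q\<^sup>3 G(Q) H(Q) H(Q\<^sup>2) - q\<^sup>4 H(Q)\<^sup>2 H(Q\<^sup>2)\<close>.
  All four products have nonnegative coefficients. Those containing \<open>G(Q)\<close> dominate \<open>1/(1 - Q)\<close>
  coefficientwise, hence are positive everywhere; the other two dominate \<open>1/((1 - Q\<^sup>2)(1 - Q\<^sup>3))\<close>, whose
  coefficient vanishes only at the exponent 1. That is the source of the exception \<open>n = 1\<close>.
\<close>

section \<open>Infinite q-shifted factorials\<close>

lemma convergent_prod_qpoch:
  assumes "norm q < 1"
  shows "convergent_prod (\<lambda>n. 1 - a * q ^ n :: complex)"
proof -
  have "summable (\<lambda>n. norm (1 - a * q ^ n - 1))"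
    using assms by (simp add: norm_mult norm_power summable_mult summable_geometric)
  then show ?thesis
    by (intro abs_convergent_prod_imp_convergent_prod summable_imp_abs_convergent_prod)
qed

text \<open>A convergent infinite product vanishes only if one of its factors does, and here every factor is
  within \<open>norm a\<close> of 1.\<close>
lemma qpoch_inf_nonzero:
  assumes "norm q < 1" "norm a < 1"
  shows "qpoch_inf a q \<noteq> 0"
  unfolding qpoch_inf_def
proof (rule prodinf_nonzero[OF convergent_prod_qpoch[OF assms(1)]])
  fix n
  have "norm (a * q ^ n) \<le> norm a * 1"
    unfolding norm_mult norm_power using assms(1)
    by (intro mult_left_mono power_le_one) auto
  with assms(2) show "1 - a * q ^ n \<noteq> 0"
    by auto
qed

lemma qpoch_inf_zero [simp]: "qpoch_inf 0 q = 1"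
  by (simp add: qpoch_inf_def)

lemma qpoch_inf_split_head:
  assumes "norm q < 1"
  shows "qpoch_inf a q = (1 - a) * qpoch_inf (a * q) q"
proof -
  have "(\<lambda>n. \<Prod>i<Suc n. 1 - a * q ^ i) \<longlonglongrightarrow> qpoch_inf a q"
    by (rule LIMSEQ_Suc[OF qpoch_lim[OF assms]])
  moreover have "(\<lambda>n. (1 - a) * (\<Prod>i<n. 1 - (a * q) * q ^ i)) \<longlonglongrightarrow> (1 - a) * qpoch_inf (a * q) q"
    by (intro tendsto_mult tendsto_const qpoch_lim assms)
  moreover have "(\<Prod>i<Suc n. 1 - a * q ^ i) = (1 - a) * (\<Prod>i<n. 1 - (a * q) * q ^ i)" for n
    by (subst prod.lessThan_Suc_shift) (simp add: mult.assoc)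
  ultimately show ?thesis
    by (simp add: LIMSEQ_unique)
qed

lemma qpoch_inf_multisect:
  assumes "norm q < 1" "k > 0"
  shows "qpoch_inf a q = (\<Prod>i<k. qpoch_inf (a * q ^ i) (q ^ k))"
proof -
  have qk: "norm (q ^ k) < 1"
    using assms by (simp add: norm_power power_less_one_iff)
  have "(\<lambda>n. \<Prod>i<n * k. 1 - a * q ^ i) \<longlonglongrightarrow> qpoch_inf a q"
    using filterlim_compose[OF qpoch_lim[OF assms(1)] mult_nat_right_at_top[OF assms(2)]] .
  moreover have "(\<Prod>i<n * k. 1 - a * q ^ i) = (\<Prod>i<k. \<Prod>m<n. 1 - (a * q ^ i) * (q ^ k) ^ m)" for n
  proof -
    have "(\<Prod>i<n * k. 1 - a * q ^ i) = (\<Prod>m<n. \<Prod>i = m * k..<m * k + k. 1 - a * q ^ i)"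
      by (rule prod.nat_group [symmetric])
    also have "\<dots> = (\<Prod>m<n. \<Prod>i<k. 1 - (a * q ^ i) * (q ^ k) ^ m)"
    proof (rule prod.cong[OF refl])
      fix m
      show "(\<Prod>i = m * k..<m * k + k. 1 - a * q ^ i) = (\<Prod>i<k. 1 - (a * q ^ i) * (q ^ k) ^ m)"
        by (rule prod.reindex_bij_witness[of _ "\<lambda>i. m * k + i" "\<lambda>i. i - m * k"])
           (auto simp flip: power_mult power_add simp: algebra_simps)
    qed
    finally show ?thesis
      by (simp add: prod.swap[of _ "{..<k}"])
  qed
  moreover have "(\<lambda>n. \<Prod>i<k. \<Prod>m<n. 1 - (a * q ^ i) * (q ^ k) ^ m) \<longlonglongrightarrow>
                 (\<Prod>i<k. qpoch_inf (a * q ^ i) (q ^ k))"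
    by (intro tendsto_prod qpoch_lim qk)
  ultimately show ?thesis
    by (simp add: LIMSEQ_unique)
qed

section \<open>Theta series\<close>

text \<open>The integer \<open>n (n - 1) / 2\<close> for negative \<open>n\<close> as well. Identities between exponents of theta
  series become polynomial identities once they are doubled, through \<open>two_binom2\<close>.\<close>
definition binom2 :: "int \<Rightarrow> int" where
  "binom2 n = n * (n - 1) div 2"

lemma two_binom2: "2 * binom2 n = n * (n - 1)"
  unfolding binom2_def by (cases "even n") auto

text \<open>Ramanujan's \<open>f(z, p/z)\<close>. Taking the nome \<open>p\<close> as the second argument keeps quasi-periodicity under
  \<open>z \<mapsto> p z\<close> simple.\<close>
definition theta :: "complex \<Rightarrow> complex \<Rightarrow> complex" where
  "theta z p = (\<Sum>\<^sub>\<infinity>n. z powi n * p powi binom2 n)"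

lemma summable_theta_nat:
  fixes z p :: complex
  assumes "norm p < 1" "p \<noteq> 0"
  shows "(\<lambda>n::nat. z powi int n * p powi binom2 (int n)) summable_on UNIV"
proof -
  let ?f = "\<lambda>n::nat. norm (z powi int n * p powi binom2 (int n))"
  have step: "?f (Suc n) = (norm z * norm p ^ n) * ?f n" for n
  proof -
    have "binom2 (int (Suc n)) = binom2 (int n) + int n"
      using two_binom2[of "int n"] two_binom2[of "int (Suc n)"] by (simp add: algebra_simps)
    moreover have "p powi (binom2 (int n) + int n) = p powi binom2 (int n) * p ^ n"
      using assms by (simp add: power_int_add)
    ultimately show ?thesis
      by (simp only: power_int_of_nat power_Suc norm_mult norm_power) (simp add: mult_ac)
  qed
  have "(\<lambda>n. norm z * norm p ^ n) \<longlonglongrightarrow> norm z * 0"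
    using assms by (intro tendsto_mult tendsto_const LIMSEQ_power_zero) simp
  then have "eventually (\<lambda>n. norm z * norm p ^ n < 1/2) sequentially"
    by (rule order_tendstoD(2)) simp
  then obtain N where N: "\<And>n. n \<ge> N \<Longrightarrow> norm z * norm p ^ n < 1/2"
    by (auto simp: eventually_sequentially)
  have "summable ?f"
  proof (rule summable_ratio_test[of "1/2" N])
    fix n assume "n \<ge> N"
    from mult_right_mono[OF less_imp_le[OF N[OF this]], of "?f n"]
    show "norm (?f (Suc n)) \<le> 1/2 * norm (?f n)"
      unfolding step by simp
  qed simp
  then show ?thesis
    by (rule norm_summable_imp_summable_on)
qed

lemma theta_has_sum:
  assumes "norm p < 1" "p \<noteq> 0" "z \<noteq> 0"
  shows "((\<lambda>n. z powi n * p powi binom2 n) has_sum theta z p) UNIV"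
proof -
  let ?f = "\<lambda>n. z powi n * p powi binom2 n"
  have "?f summable_on {0..}"
    using summable_theta_nat[OF assms(1,2), of z]
    by (subst (asm) summable_on_reindex_bij_witness[of _ nat int "{0..}" ?f]) auto
  moreover have "?f summable_on {..0}"
  proof -
    have "(\<lambda>n::nat. (p / z) powi int n * p powi binom2 (int n)) summable_on UNIV"
      by (rule summable_theta_nat[OF assms(1,2)])
    also have "?this \<longleftrightarrow> ?f summable_on {..0}"
    proof (rule summable_on_reindex_bij_witness[of _ "\<lambda>n. nat (-n)" "\<lambda>n. - int n"])
      fix n :: nat
      have "binom2 (- int n) = int n + binom2 (int n)"
        using two_binom2[of "- int n"] two_binom2[of "int n"] by (simp add: algebra_simps)
      moreover have "p powi (int n + binom2 (int n)) = p ^ n * p powi binom2 (int n)"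
        using assms by (simp add: power_int_add)
      ultimately show "z powi - int n * p powi binom2 (- int n) = (p / z) powi int n * p powi binom2 (int n)"
        by (simp add: power_int_minus power_divide field_simps)
    qed auto
    finally show ?thesis .
  qed
  ultimately have "?f summable_on ({0..} \<union> {..0})"
    by (rule summable_on_union)
  also have "{0..} \<union> {..0} = (UNIV :: int set)"
    by auto
  finally show ?thesis
    unfolding theta_def by (rule has_sum_infsum)
qed

lemma has_sum_product_complex:
  fixes f :: "'a \<Rightarrow> complex" and g :: "'b \<Rightarrow> complex"
  assumes f: "(f has_sum F) A" and g: "(g has_sum G) B"
  shows "((\<lambda>(x, y). f x * g y) has_sum F * G) (A \<times> B)"
proof (rule has_sum_SigmaI)
  show "((\<lambda>y. case (x, y) of (x, y) \<Rightarrow> f x * g y) has_sum f x * G) B" for x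
    using has_sum_cmult_right[OF g] by simp
  show "((\<lambda>x. f x * G) has_sum F * G) A"
    by (rule has_sum_cmult_left[OF f])
  have "(\<lambda>x. norm (f x)) summable_on A" "(\<lambda>y. norm (g y)) summable_on B"
    using f g has_sum_imp_summable summable_on_iff_abs_summable_on_complex by blast+
  then have "(\<lambda>z. norm (case z of (x, y) \<Rightarrow> f x * g y)) summable_on A \<times> B"
    by (subst Infinite_Sum.abs_summable_on_Sigma_iff) (auto simp: norm_mult abs_mult infsum_nonneg infsum_cmult_right'
        intro!: summable_on_cmult_right summable_on_cmult_left infsum_nonneg)
  then show "(\<lambda>(x, y). f x * g y) summable_on A \<times> B"
    by (rule abs_summable_summable)
qed

lemma theta_shift:
  assumes "norm p < 1" "p \<noteq> 0" "z \<noteq> 0"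
  shows "theta (p * z) p = theta z p / z"
proof -
  have "((\<lambda>n. (p * z) powi n * p powi binom2 n) has_sum theta z p / z) UNIV
     \<longleftrightarrow> ((\<lambda>n. (z powi n * p powi binom2 n) * (1 / z)) has_sum theta z p / z) UNIV"
  proof (rule has_sum_reindex_bij_witness[of _ "\<lambda>n. n - 1" "\<lambda>n. n + 1"])
    fix n :: int
    have "binom2 (n + 1) = n + binom2 n"
      using two_binom2[of n] two_binom2[of "n + 1"] by (simp add: algebra_simps)
    then show "z powi (n + 1) * p powi binom2 (n + 1) * (1 / z) = (p * z) powi n * p powi binom2 n"
      using assms by (simp add: power_int_add power_int_mult_distrib)
  qed auto
  moreover have "((\<lambda>n. (z powi n * p powi binom2 n) * (1 / z)) has_sum theta z p * (1 / z)) UNIV"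
    by (intro has_sum_cmult_left theta_has_sum assms)
  ultimately have "((\<lambda>n. (p * z) powi n * p powi binom2 n) has_sum theta z p / z) UNIV"
    by simp
  from has_sum_unique[OF theta_has_sum this] show ?thesis
    using assms by simp
qed

lemma theta_symmetric:
  assumes "norm p < 1" "p \<noteq> 0" "z \<noteq> 0"
  shows "theta (p / z) p = theta z p"
proof -
  have "((\<lambda>n. (p / z) powi n * p powi binom2 n) has_sum theta z p) UNIV
     \<longleftrightarrow> ((\<lambda>n. z powi n * p powi binom2 n) has_sum theta z p) UNIV"
  proof (rule has_sum_reindex_bij_witness[of _ uminus uminus])
    fix n :: int
    have "binom2 (- n) = n + binom2 n"
      using two_binom2[of n] two_binom2[of "- n"] by (simp add: algebra_simps)
    then show "z powi - n * p powi binom2 (- n) = (p / z) powi n * p powi binom2 n"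
      using assms by (simp add: power_int_add power_int_divide_distrib power_int_minus field_simps)
  qed auto
  then have "((\<lambda>n. (p / z) powi n * p powi binom2 n) has_sum theta z p) UNIV"
    using theta_has_sum assms by simp
  from has_sum_unique[OF theta_has_sum this] show ?thesis
    using assms by simp
qed

text \<open>The symmetry \<open>z \<mapsto> p/z\<close> and the quasi-periodicity \<open>z \<mapsto> p z\<close> relate the value at \<open>-1\<close> to itself
  with opposite signs.\<close>
lemma theta_minus_one:
  assumes "norm p < 1" "p \<noteq> 0"
  shows "theta (-1) p = 0"
proof -
  have "theta (-1) p = theta (p * (-1)) p"
    using theta_symmetric[of p "-1"] assms by simp
  also have "\<dots> = - theta (-1) p"
    using theta_shift[of p "-1"] assms by simp
  finally show ?thesis by simp
qed

text \<open>In the double series over \<open>(m, n)\<close>, the pairs with \<open>m + n\<close> even are parametrised as \<open>(i + j, i - j)\<close>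
  and those with \<open>m + n\<close> odd as \<open>(i + j, i - j + 1)\<close>. In both cases the mixed term \<open>i j\<close> drops out of
  the exponent of \<open>p\<close>, so that each half factors.\<close>
lemma theta_mult:
  assumes p: "norm p < 1" "p \<noteq> 0" and z: "z \<noteq> 0" and w: "w \<noteq> 0"
  shows "theta z p * theta w p =
           theta (z * w) (p\<^sup>2) * theta (p * z / w) (p\<^sup>2) + w * (theta (p * z * w) (p\<^sup>2) * theta (z / w) (p\<^sup>2))"
proof -
  have p2: "norm (p\<^sup>2) < 1" "p\<^sup>2 \<noteq> 0"
    using p by (auto simp: norm_power power_less_one_iff)
  let ?f = "\<lambda>(m, n). (z powi m * p powi binom2 m) * (w powi n * p powi binom2 n)"
  let ?E = "{(m, n :: int). even (m + n)}" and ?O = "{(m, n :: int). odd (m + n)}"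
  have p2powi: "(p\<^sup>2) powi k = p powi (2 * k)" for k
    by (simp add: power_int_mult)
  have "(?f has_sum theta (z * w) (p\<^sup>2) * theta (p * z / w) (p\<^sup>2)) ?E \<longleftrightarrow>
        ((\<lambda>(i, j). ((z * w) powi i * (p\<^sup>2) powi binom2 i) * ((p * z / w) powi j * (p\<^sup>2) powi binom2 j))
           has_sum theta (z * w) (p\<^sup>2) * theta (p * z / w) (p\<^sup>2)) (UNIV \<times> UNIV)"
  proof (rule has_sum_reindex_bij_witness[of _ "\<lambda>(i, j). (i + j, i - j)" "\<lambda>(m, n). ((m + n) div 2, (m - n) div 2)"])
    fix a assume "a \<in> ?E"
    then obtain m n where a: "a = (m, n)" and ev: "even (m + n)" by auto
    define i j where "i = (m + n) div 2" and "j = (m - n) div 2"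
    have mn: "m = i + j" "n = i - j"
      using ev unfolding i_def j_def by presburger+
    have "binom2 m + binom2 n = 2 * binom2 i + j + 2 * binom2 j"
      using two_binom2[of i] two_binom2[of j] two_binom2[of m] two_binom2[of n]
      unfolding mn by (simp add: algebra_simps)
    then have "p powi binom2 m * p powi binom2 n = p powi (2 * binom2 i) * p powi j * p powi (2 * binom2 j)"
      using p by (metis power_int_add)
    moreover have "z powi m * w powi n = (z * w) powi i * (z / w) powi j"
      unfolding mn using z w
      by (simp add: power_int_add power_int_diff power_int_mult_distrib power_int_divide_distrib)
    moreover have fm: "?f (m, n) = (z powi m * w powi n) * (p powi binom2 m * p powi binom2 n)"
      by (simp add: mult_ac)
    ultimately show "(case case a of (m, n) \<Rightarrow> ((m + n) div 2, (m - n) div 2) of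
         (i, j) \<Rightarrow> ((z * w) powi i * (p\<^sup>2) powi binom2 i) * ((p * z / w) powi j * (p\<^sup>2) powi binom2 j)) = ?f a"
      unfolding a fm using p z w
      by (simp add: p2powi power_int_mult_distrib power_int_divide_distrib flip: i_def j_def)
  qed (auto, presburger)
  moreover have "(?f has_sum w * (theta (p * z * w) (p\<^sup>2) * theta (z / w) (p\<^sup>2))) ?O \<longleftrightarrow>
        ((\<lambda>x. w * (case x of (i, j) \<Rightarrow> ((p * z * w) powi i * (p\<^sup>2) powi binom2 i) * ((z / w) powi j * (p\<^sup>2) powi binom2 j)))
           has_sum w * (theta (p * z * w) (p\<^sup>2) * theta (z / w) (p\<^sup>2))) (UNIV \<times> UNIV)"
  proof (rule has_sum_reindex_bij_witness[of _ "\<lambda>(i, j). (i + j, i - j + 1)" "\<lambda>(m, n). ((m + n - 1) div 2, (m - n + 1) div 2)"])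
    fix a assume "a \<in> ?O"
    then obtain m n where a: "a = (m, n)" and od: "odd (m + n)" by auto
    define i j where "i = (m + n - 1) div 2" and "j = (m - n + 1) div 2"
    have mn: "m = i + j" "n = i - j + 1"
      using od unfolding i_def j_def by presburger+
    have "binom2 m + binom2 n = i + 2 * binom2 i + 2 * binom2 j"
      using two_binom2[of i] two_binom2[of j] two_binom2[of m] two_binom2[of n]
      unfolding mn by (simp add: algebra_simps)
    then have "p powi binom2 m * p powi binom2 n = p powi i * p powi (2 * binom2 i) * p powi (2 * binom2 j)"
      using p by (metis power_int_add)
    moreover have "z powi m * w powi n = w * ((z * w) powi i * (z / w) powi j)"
      unfolding mn using z w
      by (simp add: power_int_add power_int_diff power_int_mult_distrib power_int_divide_distrib)
    moreover have fm: "?f (m, n) = (z powi m * w powi n) * (p powi binom2 m * p powi binom2 n)"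
      by (simp add: mult_ac)
    ultimately show "w * (case case a of (m, n) \<Rightarrow> ((m + n - 1) div 2, (m - n + 1) div 2) of
         (i, j) \<Rightarrow> ((p * z * w) powi i * (p\<^sup>2) powi binom2 i) * ((z / w) powi j * (p\<^sup>2) powi binom2 j)) = ?f a"
      unfolding a fm using p z w
      by (simp add: p2powi power_int_mult_distrib power_int_divide_distrib flip: i_def j_def)
  qed (auto, presburger+)
  moreover have
    "((\<lambda>(i, j). ((z * w) powi i * (p\<^sup>2) powi binom2 i) * ((p * z / w) powi j * (p\<^sup>2) powi binom2 j))
        has_sum theta (z * w) (p\<^sup>2) * theta (p * z / w) (p\<^sup>2)) (UNIV \<times> UNIV)"
    using p p2 z w by (intro has_sum_product_complex theta_has_sum) auto
  moreover have
    "((\<lambda>x. w * (case x of (i, j) \<Rightarrow> ((p * z * w) powi i * (p\<^sup>2) powi binom2 i) * ((z / w) powi j * (p\<^sup>2) powi binom2 j)))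
        has_sum w * (theta (p * z * w) (p\<^sup>2) * theta (z / w) (p\<^sup>2))) (UNIV \<times> UNIV)"
    using p p2 z w by (intro has_sum_cmult_right has_sum_product_complex theta_has_sum) auto
  ultimately have "(?f has_sum theta (z * w) (p\<^sup>2) * theta (p * z / w) (p\<^sup>2)) ?E"
      "(?f has_sum w * (theta (p * z * w) (p\<^sup>2) * theta (z / w) (p\<^sup>2))) ?O"
    by blast+
  then have "(?f has_sum (theta (z * w) (p\<^sup>2) * theta (p * z / w) (p\<^sup>2)
         + w * (theta (p * z * w) (p\<^sup>2) * theta (z / w) (p\<^sup>2)))) (?E \<union> ?O)"
    by (rule has_sum_Un_disjoint) auto
  also have "?E \<union> ?O = UNIV \<times> UNIV"
    by auto
  finally show ?thesis
    using has_sum_unique has_sum_product_complex[OF theta_has_sum[OF p z] theta_has_sum[OF p w]]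
    by blast
qed

section \<open>The Jacobi triple product\<close>

definition qfact :: "complex \<Rightarrow> nat \<Rightarrow> complex" where
  "qfact p m = (\<Prod>i<m. 1 - p * p ^ i)"

text \<open>Extending \<open>1/(p; p)\<^sub>k\<close> by 0 to negative \<open>k\<close> is forced by its recursion, whose factor \<open>1 - p\<^sup>k\<close>
  vanishes at \<open>k = 0\<close>. The Gaussian binomial coefficients below then need no range restrictions.\<close>
definition inv_qfact :: "complex \<Rightarrow> int \<Rightarrow> complex" where
  "inv_qfact p k = (if k < 0 then 0 else inverse (qfact p (nat k)))"

lemma qfact_nonzero:
  assumes "norm p < 1"
  shows "qfact p m \<noteq> 0"
proof -
  have "1 - p * p ^ i \<noteq> 0" for i
  proof -
    have "norm (p ^ Suc i) < 1"
      using assms by (simp only: norm_power power_less_one_iff[of "norm p"] norm_ge_zero) auto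
    then show ?thesis by auto
  qed
  then show ?thesis by (simp add: qfact_def)
qed

lemma inv_qfact_rec:
  assumes "norm p < 1"
  shows "inv_qfact p (k - 1) = (1 - p powi k) * inv_qfact p k"
proof (cases "k > 0")
  case True
  define m where "m = nat (k - 1)"
  have k: "k = int (Suc m)" "nat k = Suc m" "nat (k - 1) = m"
    using True by (auto simp: m_def)
  have "qfact p (Suc m) = qfact p m * (1 - p ^ Suc m)"
    by (simp add: qfact_def)
  moreover have "p powi k = p ^ Suc m"
    unfolding k(1) power_int_of_nat ..
  ultimately show ?thesis
    using qfact_nonzero[OF assms, of "Suc m"] qfact_nonzero[OF assms, of m] True
    unfolding inv_qfact_def k(2,3) by (simp add: field_simps del: power_Suc)
qed (auto simp: inv_qfact_def)

text \<open>The coefficients are the Gaussian binomial coefficients \<open>2 n\<close> over \<open>n + k\<close>. Passing from \<open>n\<close> to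
  \<open>n + 1\<close> multiplies by \<open>1 + p\<^bsup>2n+1\<^esup> + z p\<^sup>n + p\<^bsup>n+1\<^esup>/z\<close>, which turns the claim into a three-term
  recursion in \<open>k\<close>. Stated as a sum over all integers, both sides can be shifted in \<open>k\<close> freely.\<close>
lemma finite_jacobi_triple_product:
  assumes p: "norm p < 1" "p \<noteq> 0" and z: "z \<noteq> 0"
  shows "((\<lambda>k. qfact p (2 * n) * inv_qfact p (int n - k) * inv_qfact p (int n + k) *
            (z powi k * p powi binom2 k))
          has_sum (\<Prod>i<n. (1 + z * p ^ i) * (1 + p / z * p ^ i))) UNIV"
proof (induction n)
  case 0
  have "((\<lambda>k. qfact p 0 * inv_qfact p (- k) * inv_qfact p k * (z powi k * p powi binom2 k))
          has_sum (\<Sum>k\<in>{0}. qfact p 0 * inv_qfact p (- k) * inv_qfact p k * (z powi k * p powi binom2 k))) UNIV"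
    by (rule has_sum_finite_neutralI[where B = "{0}"]) (auto simp: inv_qfact_def)
  then show ?case
    by (simp add: inv_qfact_def qfact_def binom2_def)
next
  case (Suc n)
  let ?t = "\<lambda>k. z powi k * p powi binom2 k"
  define f where "f = (\<lambda>n k. qfact p (2 * n) * inv_qfact p (int n - k) * inv_qfact p (int n + k) * ?t k)"
  define P where "P = (\<Prod>i<n. (1 + z * p ^ i) * (1 + p / z * p ^ i))"
  have IH: "(f n has_sum P) UNIV"
    using Suc.IH by (simp only: f_def P_def)
  have shift: "((\<lambda>k. f n (k + d)) has_sum P) UNIV" for d
    using IH by (subst has_sum_reindex_bij_witness[of _ "\<lambda>k. k - d" "\<lambda>k. k + d" UNIV "f n"]) auto
  have rec: "f (Suc n) k = (1 + p ^ (2 * n + 1)) * f n k + z * p ^ n * f n (k - 1) + p ^ Suc n / z * f n (k + 1)" for k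
  proof -
    \<comment> \<open>In \<open>x\<close> and \<open>y\<close> the recursion becomes a polynomial identity, since \<open>x y = p\<^bsup>2n\<^esup>\<close>.\<close>
    define x y where "x = p powi (int n + k)" and "y = p powi (int n - k)"
    define u v where "u = inv_qfact p (int n + 1 + k)" and "v = inv_qfact p (int n + 1 - k)"
    have xy: "p ^ (2 * n) = x * y"
      using p unfolding x_def y_def by (simp flip: power_int_add power_int_of_nat)
    then have h: "p ^ (2 * n + 1) = p * (x * y)"
      by simp
    have px: "p powi (int n + 1 + k) = p * x" and py: "p powi (int n + 1 - k) = p * y"
      using p unfolding x_def y_def by (simp_all add: power_int_add power_int_diff)
    have r: "inv_qfact p (int n + k) = (1 - p * x) * u" "inv_qfact p (int n - k) = (1 - p * y) * v"
      using inv_qfact_rec[OF p(1), of "int n + 1 + k"] inv_qfact_rec[OF p(1), of "int n + 1 - k"]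
      unfolding px py by (simp_all add: u_def v_def)
    have r': "inv_qfact p (int n + k - 1) = (1 - x) * ((1 - p * x) * u)"
             "inv_qfact p (int n - k - 1) = (1 - y) * ((1 - p * y) * v)"
      using inv_qfact_rec[OF p(1), of "int n + k"] inv_qfact_rec[OF p(1), of "int n - k"]
      unfolding r x_def [symmetric] y_def [symmetric] by simp_all
    have e: "int n + (k + 1) = int n + 1 + k" "int n - (k - 1) = int n + 1 - k"
      "int n + (k - 1) = int n + k - 1" "int n - (k + 1) = int n - k - 1"
      by simp_all
    have bl: "binom2 k = binom2 (k - 1) + (k - 1)" and br: "binom2 (k + 1) = binom2 k + k"
      using two_binom2[of k] two_binom2[of "k + 1"] two_binom2[of "k - 1"] by (simp_all add: algebra_simps)
    have "z powi k = z powi (k - 1) * z" "p powi binom2 k * y * p = p powi binom2 (k - 1) * p ^ n"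
      unfolding bl y_def using p z by (simp_all add: power_int_add power_int_diff)
    then have tl: "z * p ^ n * ?t (k - 1) = p * y * ?t k"
      by (simp add: mult_ac)
    have "z powi (k + 1) = z powi k * z" "p powi binom2 (k + 1) * p ^ n = p powi binom2 k * x"
      unfolding br x_def using p z by (simp_all add: power_int_add power_int_diff)
    then have tr: "p ^ Suc n / z * ?t (k + 1) = p * x * ?t k"
      using z by (simp add: mult_ac)
    have q: "qfact p (2 * Suc n) = qfact p (2 * n) * ((1 - p * (x * y)) * (1 - p\<^sup>2 * (x * y)))"
      by (simp add: qfact_def flip: xy) (simp add: power2_eq_square mult_ac)
    have "f (Suc n) k = qfact p (2 * n) * u * v * ?t k * ((1 - p * (x * y)) * (1 - p\<^sup>2 * (x * y)))"
      unfolding f_def q by (simp add: u_def v_def algebra_simps)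
    also have "(1 - p * (x * y)) * (1 - p\<^sup>2 * (x * y)) = (1 + p * (x * y)) * (1 - p * y) * (1 - p * x)
        + p * y * (1 - x) * (1 - p * x) + p * x * (1 - y) * (1 - p * y)"
      by (simp add: algebra_simps power2_eq_square)
    also have "qfact p (2 * n) * u * v * ?t k * \<dots> = (1 + p ^ (2 * n + 1)) * f n k +
         (qfact p (2 * n) * v * ((1 - x) * ((1 - p * x) * u))) * (p * y * ?t k) +
         (qfact p (2 * n) * ((1 - y) * ((1 - p * y) * v)) * u) * (p * x * ?t k)"
      unfolding f_def r h by (simp add: algebra_simps)
    also have "\<dots> = (1 + p ^ (2 * n + 1)) * f n k + z * p ^ n * f n (k - 1) + p ^ Suc n / z * f n (k + 1)"
      unfolding f_def e r' u_def [symmetric] v_def [symmetric] tl [symmetric] tr [symmetric] by (simp only: mult_ac)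
    finally show ?thesis .
  qed
  have "((\<lambda>k. (1 + p ^ (2 * n + 1)) * f n k + z * p ^ n * f n (k - 1) + p ^ Suc n / z * f n (k + 1))
      has_sum ((1 + p ^ (2 * n + 1)) * P + z * p ^ n * P + p ^ Suc n / z * P)) UNIV"
    using IH shift[of "-1"] shift[of 1] by (intro has_sum_add has_sum_cmult_right) auto
  then have "(f (Suc n) has_sum ((1 + p ^ (2 * n + 1)) * P + z * p ^ n * P + p ^ Suc n / z * P)) UNIV"
    by (simp only: rec[symmetric])
  also have "(1 + p ^ (2 * n + 1)) * P + z * p ^ n * P + p ^ Suc n / z * P =
      (\<Prod>i<Suc n. (1 + z * p ^ i) * (1 + p / z * p ^ i))"
    unfolding prod.lessThan_Suc P_def [symmetric] using z
    by (simp only: power_add mult_2) (simp add: field_simps)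
  finally show ?case
    by (simp only: f_def)
qed

lemma qfact_tendsto: "norm p < 1 \<Longrightarrow> qfact p \<longlonglongrightarrow> qpoch_inf p p"
  using qpoch_lim[of p p] by (simp add: qfact_def[abs_def])

text \<open>The limit of the finite version: for fixed \<open>k\<close> the Gaussian binomial coefficient tends to
  \<open>1/(p; p)\<close>, and all of them are bounded, so a multiple of the theta series dominates.\<close>
theorem jacobi_triple_product:
  assumes p: "norm p < 1" "p \<noteq> 0" and z: "z \<noteq> 0"
  shows "theta z p = qpoch_inf (- z) p * qpoch_inf (- (p / z)) p * qpoch_inf p p"
proof -
  let ?t = "\<lambda>k. z powi k * p powi binom2 k"
  define C where "C = (\<lambda>n k. qfact p (2 * n) * inv_qfact p (int n - k) * inv_qfact p (int n + k))"
  let ?P = "qpoch_inf p p"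
  have P0: "?P \<noteq> 0"
    using qpoch_inf_nonzero[of p p] p by simp
  have inv_lim: "(\<lambda>m. inverse (qfact p m)) \<longlonglongrightarrow> inverse ?P"
    by (intro tendsto_inverse qfact_tendsto p P0)
  \<comment> \<open>The partial products of \<open>(p; p)\<close> have a nonzero limit, so they and their inverses are bounded.\<close>
  have "Bseq (qfact p)" "Bseq (\<lambda>m. inverse (qfact p m))"
    using qfact_tendsto[OF p(1)] inv_lim convergentI Bseq_conv_Bfun convergent_imp_Bseq by blast+
  then obtain K L where KL: "\<And>m. norm (qfact p m) \<le> K" "\<And>m. norm (inverse (qfact p m)) \<le> L"
    by (meson BseqE)
  have K0: "K \<ge> 0" and L0: "L \<ge> 0"
    using KL norm_ge_zero order_trans by blast+
  have Lb: "norm (inv_qfact p k) \<le> L" for k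
    using KL(2)[of "nat k"] L0 by (simp add: inv_qfact_def)
  have Cb: "norm (C n k) \<le> K * L * L" for n k
    unfolding C_def norm_mult by (intro mult_mono KL Lb mult_nonneg_nonneg K0 L0 norm_ge_zero)
  have Clim: "(\<lambda>n. C n k) \<longlonglongrightarrow> ?P * inverse ?P * inverse ?P" for k
  proof -
    have inv: "(\<lambda>n. inv_qfact p (int n + d)) \<longlonglongrightarrow> inverse ?P" for d
    proof (rule Lim_transform_eventually)
      have "filterlim (\<lambda>n. nat (int n + d)) at_top sequentially"
        unfolding filterlim_at_top
      proof
        fix Z show "eventually (\<lambda>n. Z \<le> nat (int n + d)) sequentially"
          using eventually_ge_at_top[of "nat (int Z + \<bar>d\<bar>)"] by eventually_elim linarith
      qed
      then show "(\<lambda>n. inverse (qfact p (nat (int n + d)))) \<longlonglongrightarrow> inverse ?P"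
        by (rule filterlim_compose[OF inv_lim])
      show "eventually (\<lambda>n. inverse (qfact p (nat (int n + d))) = inv_qfact p (int n + d)) sequentially"
        using eventually_ge_at_top[of "nat \<bar>d\<bar>"] by eventually_elim (auto simp: inv_qfact_def)
    qed
    have "(\<lambda>n. qfact p (2 * n)) \<longlonglongrightarrow> ?P"
      by (rule filterlim_compose[OF qfact_tendsto[OF p(1)]]) (rule mult_nat_left_at_top, simp)
    from tendsto_mult[OF tendsto_mult[OF this inv[of "-k"]] inv[of k]] show ?thesis
      by (simp add: C_def)
  qed
  \<comment> \<open>Dominated convergence is applied to ordinary series, along an enumeration of the integers.\<close>
  have sums: "(\<lambda>i. g (int_decode i)) sums S" if "(g has_sum S) UNIV" for g :: "int \<Rightarrow> complex" and S
    using that by (intro has_sum_imp_sums) (simp add: has_sum_reindex_bij_betw[OF bij_int_decode])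
  have t_sum: "(?t has_sum theta z p) UNIV"
    by (intro theta_has_sum p z)
  have "summable (\<lambda>i. K * L * L * norm (?t (int_decode i)))"
  proof (rule summable_mult)
    have "(\<lambda>k. norm (?t k)) summable_on UNIV"
      by (rule summable_on_iff_abs_summable_on_complex[THEN iffD1, OF has_sum_imp_summable[OF t_sum]])
    then show "summable (\<lambda>i. norm (?t (int_decode i)))"
      by (intro summable_on_imp_summable)
         (subst summable_on_reindex_bij_betw[OF bij_int_decode, of "\<lambda>k. norm (?t k)"])
  qed
  moreover have "norm (C n (int_decode i) * ?t (int_decode i)) \<le> K * L * L * norm (?t (int_decode i))" for n i
    unfolding norm_mult[of "C n _"] by (intro mult_right_mono Cb norm_ge_zero)
  ultimately have "(\<lambda>n. suminf (\<lambda>i. C n (int_decode i) * ?t (int_decode i)))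
      \<longlonglongrightarrow> suminf (\<lambda>i. (?P * inverse ?P * inverse ?P) * ?t (int_decode i))"
    using tannerys_theorem[where F = sequentially
        and a = "\<lambda>i n. C n (int_decode i) * ?t (int_decode i)"
        and b = "\<lambda>i. (?P * inverse ?P * inverse ?P) * ?t (int_decode i)"
        and M = "\<lambda>i. K * L * L * norm (?t (int_decode i))"]
      tendsto_mult_right[OF Clim]
    by (simp only: split_beta always_eventually sequentially_bot simp_thms)
  moreover have "suminf (\<lambda>i. (?P * inverse ?P * inverse ?P) * ?t (int_decode i)) = (?P * inverse ?P * inverse ?P) * theta z p"
    by (rule sums_unique[OF sums[OF has_sum_cmult_right[OF t_sum]], symmetric])
  moreover have "suminf (\<lambda>i. C n (int_decode i) * ?t (int_decode i)) = (\<Prod>i<n. (1 + z * p ^ i) * (1 + p / z * p ^ i))" for n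
    unfolding C_def by (rule sums_unique[OF sums[OF finite_jacobi_triple_product[OF p z]], symmetric])
  moreover have "(\<lambda>n. \<Prod>i<n. (1 + z * p ^ i) * (1 + p / z * p ^ i)) \<longlonglongrightarrow> qpoch_inf (- z) p * qpoch_inf (- (p / z)) p"
    using tendsto_mult[OF qpoch_lim[OF p(1), of "- z"] qpoch_lim[OF p(1), of "- (p / z)"]]
    by (simp add: prod.distrib)
  ultimately have "(?P * inverse ?P * inverse ?P) * theta z p = qpoch_inf (- z) p * qpoch_inf (- (p / z)) p"
    by (simp only: LIMSEQ_unique)
  then show ?thesis
    using P0 by (simp add: field_simps)
qed

section \<open>A five-term expansion of a product of three thetas\<close>

text \<open>The exponent of \<open>Q\<close> in the term of \<open>theta(w; Q)\<^sup>2 theta(-w; Q\<^sup>2)\<close> with summation indices \<open>x\<close>, \<open>y\<close>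
  and \<open>z = k - x - y\<close>; the corresponding power of \<open>w\<close> is \<open>w\<^sup>k\<close>.\<close>
definition quint_exp :: "int \<Rightarrow> int \<times> int \<Rightarrow> int" where
  "quint_exp k = (\<lambda>(x, y). binom2 x + binom2 y + 2 * binom2 (k - x - y))"

definition quint_term :: "complex \<Rightarrow> int \<Rightarrow> int \<times> int \<Rightarrow> complex" where
  "quint_term Q k xy = (-1) powi (k - fst xy - snd xy) * Q powi quint_exp k xy"

text \<open>The Laurent coefficient of \<open>w\<^sup>k\<close> in \<open>theta(w; Q)\<^sup>2 theta(-w; Q\<^sup>2)\<close>; see \<open>has_sum_quint_coeff\<close>.\<close>
definition quint_coeff :: "complex \<Rightarrow> int \<Rightarrow> complex" where
  "quint_coeff Q k = (\<Sum>\<^sub>\<infinity>xy. quint_term Q k xy)"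

lemma neg_one_powi_simp: "(-1 :: complex) powi n = (if even n then 1 else - 1)"
  by (simp add: power_int_minus_left)

lemma has_sum_quint_triple:
  assumes Q: "norm Q < 1" "Q \<noteq> 0" and w: "w \<noteq> 0"
  shows "((\<lambda>(k, xy). w powi k * quint_term Q k xy) has_sum (theta w Q)\<^sup>2 * theta (- w) (Q\<^sup>2)) (UNIV \<times> UNIV)"
proof -
  let ?t = "\<lambda>n. w powi n * Q powi binom2 n" and ?u = "\<lambda>n. (- w) powi n * (Q\<^sup>2) powi binom2 n"
  have Q2: "norm (Q\<^sup>2) < 1" "Q\<^sup>2 \<noteq> 0"
    using Q by (auto simp: norm_power power_less_one_iff)
  have "((\<lambda>(x, yz). ?t x * (case yz of (y, z) \<Rightarrow> ?t y * ?u z)) has_sum theta w Q * (theta w Q * theta (- w) (Q\<^sup>2)))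
          (UNIV \<times> (UNIV \<times> UNIV))"
    using Q Q2 w by (intro has_sum_product_complex theta_has_sum) auto
  also have "theta w Q * (theta w Q * theta (- w) (Q\<^sup>2)) = (theta w Q)\<^sup>2 * theta (- w) (Q\<^sup>2)"
    by (simp add: power2_eq_square)
  finally have "((\<lambda>(x, y, z). ?t x * (?t y * ?u z)) has_sum (theta w Q)\<^sup>2 * theta (- w) (Q\<^sup>2))
          (UNIV \<times> (UNIV \<times> UNIV))"
    by (simp add: case_prod_unfold)
  also have "?this \<longleftrightarrow> ?thesis"
  proof (rule has_sum_reindex_bij_witness[of _ "\<lambda>(k, x, y). (x, y, k - x - y)" "\<lambda>(x, y, z). (x + y + z, x, y)"])
    fix a :: "int \<times> int \<times> int"
    obtain x y z where a: "a = (x, y, z)" by (cases a)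
    have "(Q\<^sup>2) powi binom2 z = Q powi (2 * binom2 z)"
      by (simp add: power_int_mult)
    moreover have "(- w) powi z = (-1) powi z * w powi z"
      using power_int_mult_distrib[of "-1" w z] by simp
    ultimately show "(case case a of (x, y, z) \<Rightarrow> (x + y + z, x, y) of (k, xy) \<Rightarrow> w powi k * quint_term Q k xy)
          = (case a of (x, y, z) \<Rightarrow> ?t x * (?t y * ?u z))"
      using Q w unfolding a by (simp add: quint_term_def quint_exp_def power_int_add)
  qed auto
  finally show ?thesis .
qed

text \<open>A slice, at \<open>w = 1\<close>, of the absolutely convergent triple series.\<close>
lemma summable_quint_term:
  assumes "norm Q < 1" "Q \<noteq> 0"
  shows "quint_term Q k summable_on UNIV"
proof -
  have "(\<lambda>(k, xy). 1 powi k * quint_term Q k xy) summable_on UNIV \<times> UNIV"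
    using has_sum_imp_summable[OF has_sum_quint_triple[of Q 1]] assms by simp
  from summable_on_SigmaD1[OF this, of k] show ?thesis
    by simp
qed

lemma quint_coeff_has_sum:
  assumes "norm Q < 1" "Q \<noteq> 0"
  shows "(quint_term Q k has_sum quint_coeff Q k) UNIV"
  unfolding quint_coeff_def by (rule has_sum_infsum[OF summable_quint_term[OF assms]])

lemma has_sum_quint_coeff:
  assumes "norm Q < 1" "Q \<noteq> 0" "w \<noteq> 0"
  shows "((\<lambda>k. w powi k * quint_coeff Q k) has_sum (theta w Q)\<^sup>2 * theta (- w) (Q\<^sup>2)) UNIV"
proof (rule has_sum_Sigma'[OF has_sum_quint_triple[OF assms]])
  fix k
  show "((\<lambda>xy. case (k, xy) of (k, xy) \<Rightarrow> w powi k * quint_term Q k xy) has_sum w powi k * quint_coeff Q k) UNIV"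
    using has_sum_cmult_right[OF quint_coeff_has_sum[OF assms(1,2)]] by simp
qed

text \<open>Translating the indices \<open>(x, y, z)\<close> by \<open>(2 j, 2 j, j)\<close>, a multiple of the normal vector
  of the planes \<open>x + y + z = const\<close> with respect to the quadratic form, changes the exponent by a
  quantity that is constant on the plane \<open>x + y + z = c\<close>.\<close>
lemma quint_coeff_shift:
  assumes "Q \<noteq> 0"
  shows "quint_coeff Q (5 * j + c) = (-1) powi j * Q powi (10 * binom2 j + (2 * c + 2) * j) * quint_coeff Q c"
proof -
  have "quint_coeff Q (5 * j + c) =
      (\<Sum>\<^sub>\<infinity>xy. ((-1) powi j * Q powi (10 * binom2 j + (2 * c + 2) * j)) * quint_term Q c xy)"
    unfolding quint_coeff_def
  proof (rule infsum_reindex_bij_witness[of _ "\<lambda>(x, y). (x + 2 * j, y + 2 * j)" "\<lambda>(x, y). (x - 2 * j, y - 2 * j)"])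
    fix a :: "int \<times> int"
    define x y where "x = fst a - 2 * j" and "y = snd a - 2 * j"
    have a: "a = (x + 2 * j, y + 2 * j)"
      by (simp add: x_def y_def)
    define z where "z = c - x - y"
    have z: "5 * j + c - (x + 2 * j) - (y + 2 * j) = z + j"
      by (simp add: z_def)
    have c: "c = x + y + z"
      by (simp add: z_def)
    have "binom2 (x + 2 * j) + binom2 (y + 2 * j) + 2 * binom2 (z + j) =
        (10 * binom2 j + (2 * c + 2) * j) + (binom2 x + binom2 y + 2 * binom2 z)"
      using two_binom2[of x] two_binom2[of y] two_binom2[of z] two_binom2[of j]
        two_binom2[of "x + 2 * j"] two_binom2[of "y + 2 * j"] two_binom2[of "z + j"]
      unfolding c by (simp add: algebra_simps)
    then have "quint_exp (5 * j + c) a = (10 * binom2 j + (2 * c + 2) * j) + quint_exp c (x, y)"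
      by (simp only: quint_exp_def a case_prod_conv z z_def [symmetric])
    moreover have "(-1) powi (5 * j + c - fst a - snd a) = (-1) powi j * ((-1) powi (c - x - y) :: complex)"
      by (simp only: a fst_conv snd_conv z z_def [symmetric]) (simp add: power_int_add)
    moreover have "(case a of (x, y) \<Rightarrow> (x - 2 * j, y - 2 * j)) = (x, y)"
      by (simp add: a)
    ultimately show "(-1) powi j * Q powi (10 * binom2 j + (2 * c + 2) * j) *
        quint_term Q c (case a of (x, y) \<Rightarrow> (x - 2 * j, y - 2 * j)) = quint_term Q (5 * j + c) a"
      using assms by (simp add: quint_term_def power_int_add)
  qed auto
  then show ?thesis
    by (simp add: quint_coeff_def infsum_cmult_right')
qed

text \<open>The substitution \<open>n \<mapsto> 1 - n\<close> in all three indices preserves the exponent and flips the sign.\<close>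
lemma quint_coeff_reflect: "quint_coeff Q (3 - k) = - quint_coeff Q k"
proof -
  have "quint_coeff Q (3 - k) = (\<Sum>\<^sub>\<infinity>xy. - quint_term Q k xy)"
    unfolding quint_coeff_def
  proof (rule infsum_reindex_bij_witness[of _ "\<lambda>(x, y). (1 - x, 1 - y)" "\<lambda>(x, y). (1 - x, 1 - y)"])
    fix a :: "int \<times> int"
    define x y where "x = 1 - fst a" and "y = 1 - snd a"
    have a: "a = (1 - x, 1 - y)"
      by (simp add: x_def y_def)
    have r: "binom2 (1 - n) = binom2 n" for n
      using two_binom2[of n] two_binom2[of "1 - n"] by (simp add: algebra_simps)
    have z: "3 - k - (1 - x) - (1 - y) = 1 - (k - x - y)"
      by simp
    have "quint_exp (3 - k) a = quint_exp k (x, y)"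
      by (simp only: quint_exp_def a z r case_prod_conv)
    moreover have "(-1) powi (3 - k - fst a - snd a) = - ((-1) powi (k - x - y) :: complex)"
      unfolding a fst_conv snd_conv z by (simp add: power_int_diff power_int_minus_left)
    ultimately show "- quint_term Q k (case a of (x, y) \<Rightarrow> (1 - x, 1 - y)) = quint_term Q (3 - k) a"
      by (simp add: quint_term_def a)
  qed auto
  then show ?thesis
    by (simp add: quint_coeff_def infsum_uminus)
qed

text \<open>By \<open>quint_coeff_shift\<close>, the Laurent coefficients with index congruent to \<open>c\<close> modulo 5 are those of a
  theta series in \<open>w\<^sup>5\<close> with nome \<open>Q\<^bsup>10\<^esup>\<close>.\<close>
lemma theta_triple_dissection:
  assumes Q: "norm Q < 1" "Q \<noteq> 0" and w: "w \<noteq> 0"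
  shows "(theta w Q)\<^sup>2 * theta (- w) (Q\<^sup>2) =
    (\<Sum>c<5. w ^ c * quint_coeff Q (int c) * theta (- (w ^ 5 * Q ^ (2 * c + 2))) (Q ^ 10))"
proof -
  have Q10: "norm (Q ^ 10) < 1" "Q ^ 10 \<noteq> 0"
    using Q by (auto simp: norm_power power_less_one_iff)
  let ?S = "(theta w Q)\<^sup>2 * theta (- w) (Q\<^sup>2)"
  let ?v = "\<lambda>c. - (w ^ 5 * Q ^ (2 * c + 2))"
  have "((\<lambda>k. w powi k * quint_coeff Q k) has_sum ?S) UNIV \<longleftrightarrow>
    ((\<lambda>(c, j). (w ^ c * quint_coeff Q (int c)) * (?v c powi j * (Q ^ 10) powi binom2 j)) has_sum ?S) ({..<5} \<times> UNIV)"
  proof (rule has_sum_reindex_bij_witness[of _ "\<lambda>(c, j). 5 * j + int c" "\<lambda>k. (nat (k mod 5), k div 5)"])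
    fix k :: int
    define c j where "c = nat (k mod 5)" and "j = k div 5"
    have k: "k = 5 * j + int c"
      by (simp add: c_def j_def)
    have w_pow: "w powi k = w ^ c * (w ^ 5) powi j"
      unfolding k using w by (simp add: power_int_add power_int_mult)
    have Q_pow: "Q powi (10 * binom2 j + (2 * int c + 2) * j) = (Q ^ 10) powi binom2 j * (Q ^ (2 * c + 2)) powi j"
      using Q by (simp add: power_int_add power_int_power add.commute del: power_Suc)
    have v_pow: "?v c powi j = (-1) powi j * ((w ^ 5) powi j * (Q ^ (2 * c + 2)) powi j)"
      using power_int_mult_distrib[of "-1" "w ^ 5 * Q ^ (2 * c + 2)" j]
      by (simp only: mult_minus1 power_int_mult_distrib)
    show "(case (nat (k mod 5), k div 5) of (c, j) \<Rightarrow>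
        (w ^ c * quint_coeff Q (int c)) * (?v c powi j * (Q ^ 10) powi binom2 j)) = w powi k * quint_coeff Q k"
      unfolding c_def [symmetric] j_def [symmetric] case_prod_conv w_pow v_pow
      unfolding k quint_coeff_shift[OF Q(2)] Q_pow by (simp only: mult_ac)
  qed (auto simp: nat_less_iff)
  then have "((\<lambda>(c, j). (w ^ c * quint_coeff Q (int c)) * (?v c powi j * (Q ^ 10) powi binom2 j)) has_sum ?S)
      ({..<5} \<times> UNIV)"
    using has_sum_quint_coeff[OF assms] by simp
  then have "((\<lambda>c. w ^ c * quint_coeff Q (int c) * theta (?v c) (Q ^ 10)) has_sum ?S) {..<5}"
    by (rule has_sum_Sigma')
       (use Q Q10 w in \<open>auto intro!: has_sum_cmult_right theta_has_sum simp del: power_Suc\<close>)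
  then show ?thesis
    by (simp add: has_sum_finite_iff)
qed

text \<open>The exponent \<open>N\<close> of a term satisfies \<open>4 N - 3 = c\<^sup>2 + 5 d\<^sup>2\<close> with \<open>c = x - y\<close> and \<open>d = x + y - 3\<close>. Multiplying
  \<open>c + d \<surd>-5\<close> by \<open>1 + \<surd>-5\<close> gives \<open>24 N - 18 = a\<^sup>2 + 5 b\<^sup>2\<close> with \<open>a = 15 - 4 x - 6 y\<close> and \<open>b = 2 x - 3\<close>.
  If 3 does not divide \<open>x\<close>, then \<open>a\<close> and \<open>b\<close> are both 1 or both -1 modulo 6, and each
  of the two cases runs through all pairs of generalized pentagonal numbers. If 3 divides \<open>x\<close>, then it
  divides \<open>a\<close> and \<open>b\<close>, and those terms cancel because they contain the series \<open>theta(-1; Q\<^bsup>15\<^esup>) = 0\<close>.\<close>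
lemma quint_coeff_4:
  assumes Q: "norm Q < 1" "Q \<noteq> 0"
  shows "quint_coeff Q 4 = - 2 * Q * (theta (- Q) (Q ^ 3) * theta (- (Q ^ 5)) (Q ^ 15))"
proof -
  let ?E = "\<lambda>r. {(x, y :: int). x mod 3 = (r :: int)}"
  let ?S = "theta (- Q) (Q ^ 3) * theta (- (Q ^ 5)) (Q ^ 15)"
  have Q': "norm (Q ^ 3) < 1" "Q ^ 3 \<noteq> 0" "norm (Q ^ 15) < 1" "Q ^ 15 \<noteq> 0"
    using Q by (auto simp: norm_power power_less_one_iff)
  have pow: "(Q ^ i) powi k = Q powi (int i * k)" for i k
    by (rule power_int_power)
  have neg: "(- a) powi k = (-1) powi k * a powi k" for a :: complex and k
    using power_int_mult_distrib[of "-1" a k] by simp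
  let ?P = "\<lambda>a b (m, n). (a powi m * (Q ^ 3) powi binom2 m) * (b powi n * (Q ^ 15) powi binom2 n)"
  have S: "(?P a b has_sum theta a (Q ^ 3) * theta b (Q ^ 15)) (UNIV \<times> UNIV)" if "a \<noteq> 0" "b \<noteq> 0" for a b
    using Q' that by (intro has_sum_product_complex theta_has_sum) auto
  have E1: "(quint_term Q 4 has_sum (- Q * ?S)) (?E 1)"
  proof -
    have "((\<lambda>mn. - Q * ?P (- Q) (- (Q ^ 5)) mn) has_sum (- Q * ?S)) (UNIV \<times> UNIV)"
      using Q by (intro has_sum_cmult_right S) auto
    also have "?this \<longleftrightarrow> ?thesis"
    proof (rule has_sum_reindex_bij_witness[of _ "\<lambda>(x, y). (2 - 2 * (x div 3) - y, x div 3)" "\<lambda>(m, n). (3 * n + 1, 2 - 2 * n - m)"])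
      fix a :: "int \<times> int"
      obtain m n where a: "a = (m, n)" by (cases a)
      have "quint_exp 4 (3 * n + 1, 2 - 2 * n - m) = 1 + (m + 3 * binom2 m + (5 * n + 15 * binom2 n))"
        using two_binom2[of m] two_binom2[of n] two_binom2[of "3 * n + 1"] two_binom2[of "2 - 2 * n - m"]
          two_binom2[of "1 - n + m"]
        by (simp add: quint_exp_def algebra_simps)
      moreover have "(-1) powi (4 - (3 * n + 1) - (2 - 2 * n - m)) = - ((-1) powi m * ((-1) powi n :: complex))"
        by (auto simp: neg_one_powi_simp)
      ultimately show "quint_term Q 4 (case a of (m, n) \<Rightarrow> (3 * n + 1, 2 - 2 * n - m)) = - Q * ?P (- Q) (- (Q ^ 5)) a"
        using Q by (simp add: a quint_term_def pow neg[of Q] neg[of "Q ^ 5"] power_int_add)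
    qed (auto, presburger+)
    finally show ?thesis .
  qed
  have E2: "(quint_term Q 4 has_sum (- Q * ?S)) (?E 2)"
  proof -
    have "((\<lambda>mn. - Q * ?P (- Q) (- (Q ^ 5)) mn) has_sum (- Q * ?S)) (UNIV \<times> UNIV)"
      using Q by (intro has_sum_cmult_right S) auto
    also have "?this \<longleftrightarrow> ?thesis"
    proof (rule has_sum_reindex_bij_witness[of _ "\<lambda>(x, y). (y - 1 + 2 * (x div 3), - (x div 3))" "\<lambda>(m, n). (2 - 3 * n, 1 + 2 * n + m)"])
      fix a :: "int \<times> int"
      obtain m n where a: "a = (m, n)" by (cases a)
      have "quint_exp 4 (2 - 3 * n, 1 + 2 * n + m) = 1 + (m + 3 * binom2 m + (5 * n + 15 * binom2 n))"
        using two_binom2[of m] two_binom2[of n] two_binom2[of "2 - 3 * n"] two_binom2[of "1 + 2 * n + m"]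
          two_binom2[of "1 + n - m"]
        by (simp add: quint_exp_def algebra_simps)
      moreover have "(-1) powi (4 - (2 - 3 * n) - (1 + 2 * n + m)) = - ((-1) powi m * ((-1) powi n :: complex))"
        by (auto simp: neg_one_powi_simp)
      ultimately show "quint_term Q 4 (case a of (m, n) \<Rightarrow> (2 - 3 * n, 1 + 2 * n + m)) = - Q * ?P (- Q) (- (Q ^ 5)) a"
        using Q by (simp add: a quint_term_def pow neg[of Q] neg[of "Q ^ 5"] power_int_add)
    qed (auto, presburger+)
    finally show ?thesis .
  qed
  have E0: "(quint_term Q 4 has_sum 0) (?E 0)"
  proof -
    have "((\<lambda>mn. Q ^ 3 * ?P (- (Q ^ 3)) (-1) mn) has_sum (Q ^ 3 * (theta (- (Q ^ 3)) (Q ^ 3) * theta (- 1) (Q ^ 15)))) (UNIV \<times> UNIV)"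
      using Q by (intro has_sum_cmult_right S) auto
    also have "theta (- 1) (Q ^ 15) = 0"
      using Q' by (simp add: theta_minus_one)
    also have "((\<lambda>mn. Q ^ 3 * ?P (- (Q ^ 3)) (-1) mn) has_sum (Q ^ 3 * (theta (- (Q ^ 3)) (Q ^ 3) * 0))) (UNIV \<times> UNIV) \<longleftrightarrow> ?thesis"
    proof (rule has_sum_reindex_bij_witness[of _ "\<lambda>(x, y). (2 - 2 * (x div 3) - y, x div 3)" "\<lambda>(m, n). (3 * n, 2 - 2 * n - m)"])
      fix a :: "int \<times> int"
      obtain m n where a: "a = (m, n)" by (cases a)
      have "quint_exp 4 (3 * n, 2 - 2 * n - m) = 3 + (3 * m + 3 * binom2 m + 15 * binom2 n)"
        using two_binom2[of m] two_binom2[of n] two_binom2[of "3 * n"] two_binom2[of "2 - 2 * n - m"]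
          two_binom2[of "2 - n + m"]
        by (simp add: quint_exp_def algebra_simps)
      moreover have "(-1) powi (4 - (3 * n) - (2 - 2 * n - m)) = (-1) powi m * ((-1) powi n :: complex)"
        by (auto simp: neg_one_powi_simp)
      ultimately show "quint_term Q 4 (case a of (m, n) \<Rightarrow> (3 * n, 2 - 2 * n - m)) = Q ^ 3 * ?P (- (Q ^ 3)) (-1) a"
        using Q by (simp add: a quint_term_def pow neg[of "Q ^ 3"] power_int_add)
    qed auto
    finally show ?thesis .
  qed
  have "(quint_term Q 4 has_sum ((0 + - Q * ?S) + - Q * ?S)) ((?E 0 \<union> ?E 1) \<union> ?E 2)"
    by (intro has_sum_Un_disjoint E0 E1 E2) auto
  also have "(?E 0 \<union> ?E 1) \<union> ?E 2 = UNIV"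
    by (intro set_eqI) (clarsimp, presburger)
  finally show ?thesis
    using has_sum_unique[OF quint_coeff_has_sum[OF Q, of 4]] by simp
qed

section \<open>Evaluation of the coefficients\<close>

lemma sum_lessThan_5: "(\<Sum>c<5. g c) = g 0 + g 1 + g 2 + g 3 + g (4 :: nat)"
  for g :: "nat \<Rightarrow> 'a :: comm_monoid_add"
  by (simp add: numeral_eq_Suc)

lemma prod_lessThan_5: "(\<Prod>c<5. g c) = g 0 * g 1 * g 2 * g 3 * g (4 :: nat)"
  for g :: "nat \<Rightarrow> 'a :: comm_monoid_mult"
  by (simp add: numeral_eq_Suc)

lemma theta_neg_power:
  assumes "norm Q < 1" "Q \<noteq> 0" "k < m"
  shows "theta (- (Q ^ k)) (Q ^ m) = qpochs_inf [Q ^ k, Q ^ (m - k)] (Q ^ m) * qpoch_inf (Q ^ m) (Q ^ m)"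
proof -
  have "norm (Q ^ m) < 1"
    using assms by (simp add: norm_power power_less_one_iff)
  moreover have "Q ^ m / Q ^ k = Q ^ (m - k)"
    using assms by (simp add: power_diff)
  ultimately show ?thesis
    using assms by (subst jacobi_triple_product) (auto simp: qpochs_inf_def)
qed

lemma theta_symmetric_power:
  assumes "norm Q < 1" "Q \<noteq> 0" "0 < m" "k \<le> m"
  shows "theta (Q ^ (m - k)) (Q ^ m) = theta (Q ^ k) (Q ^ m)"
    and "theta (- (Q ^ (m - k))) (Q ^ m) = theta (- (Q ^ k)) (Q ^ m)"
proof -
  have "norm (Q ^ m) < 1"
    using assms by (simp add: norm_power power_less_one_iff)
  then show "theta (Q ^ (m - k)) (Q ^ m) = theta (Q ^ k) (Q ^ m)"
    and "theta (- (Q ^ (m - k))) (Q ^ m) = theta (- (Q ^ k)) (Q ^ m)"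
    using assms theta_symmetric[of "Q ^ m" "Q ^ k"] theta_symmetric[of "Q ^ m" "- (Q ^ k)"]
    by (simp_all add: power_diff)
qed

lemma theta_shift_power:
  assumes "norm Q < 1" "Q \<noteq> 0" "0 < m"
  shows "theta (Q ^ (m + k)) (Q ^ m) = theta (Q ^ k) (Q ^ m) / Q ^ k"
    and "theta (- (Q ^ (m + k))) (Q ^ m) = - theta (- (Q ^ k)) (Q ^ m) / Q ^ k"
proof -
  have "norm (Q ^ m) < 1"
    using assms by (simp add: norm_power power_less_one_iff)
  then show "theta (Q ^ (m + k)) (Q ^ m) = theta (Q ^ k) (Q ^ m) / Q ^ k"
    and "theta (- (Q ^ (m + k))) (Q ^ m) = - theta (- (Q ^ k)) (Q ^ m) / Q ^ k"
    using assms theta_shift[of "Q ^ m" "Q ^ k"] theta_shift[of "Q ^ m" "- (Q ^ k)"]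
    by (simp_all add: power_add)
qed

text \<open>Euler's pentagonal number theorem.\<close>
lemma theta_pentagonal:
  assumes "norm Q < 1" "Q \<noteq> 0"
  shows "theta (- Q) (Q ^ 3) = qpoch_inf Q Q"
  using theta_neg_power[OF assms, of 1 3] qpoch_inf_multisect[OF assms(1), of 3 Q]
  by (simp add: qpochs_inf_def numeral_3_eq_3 flip: power_Suc)

lemma qpoch_inf_5:
  assumes "norm Q < 1"
  shows "qpoch_inf Q Q = qpochs_inf [Q, Q ^ 4] (Q ^ 5) * qpochs_inf [Q ^ 2, Q ^ 3] (Q ^ 5) * qpoch_inf (Q ^ 5) (Q ^ 5)"
  using qpoch_inf_multisect[OF assms, of 5 Q] unfolding prod_lessThan_5
  by (simp add: qpochs_inf_def eval_nat_numeral mult_ac)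

text \<open>Both sides equal \<open>(Q; Q) (Q\<^sup>5; Q\<^sup>5)\<close>, by splitting \<open>(Q; Q)\<close> into residue classes modulo 5.\<close>
lemma theta_product_5:
  assumes "norm Q < 1" "Q \<noteq> 0"
  shows "theta (- Q) (Q ^ 3) * theta (- (Q ^ 5)) (Q ^ 15) = theta (- (Q ^ 2)) (Q ^ 5) * theta (- Q) (Q ^ 5)"
proof -
  have "norm (Q ^ 5) < 1"
    using assms by (simp add: norm_power power_less_one_iff)
  then have "theta (- (Q ^ 5)) (Q ^ 15) = qpoch_inf (Q ^ 5) (Q ^ 5)"
    using theta_pentagonal[of "Q ^ 5"] assms by (simp flip: power_mult)
  moreover note theta_pentagonal[OF assms] qpoch_inf_5[OF assms(1)]
  moreover have "theta (- (Q ^ 2)) (Q ^ 5) = qpochs_inf [Q ^ 2, Q ^ 3] (Q ^ 5) * qpoch_inf (Q ^ 5) (Q ^ 5)"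
      "theta (- Q) (Q ^ 5) = qpochs_inf [Q, Q ^ 4] (Q ^ 5) * qpoch_inf (Q ^ 5) (Q ^ 5)"
    using theta_neg_power[OF assms, of 2 5] theta_neg_power[OF assms, of 1 5] by simp_all
  ultimately show ?thesis
    by (simp add: mult_ac)
qed

text \<open>The expansion vanishes at \<open>w = -1\<close> and \<open>w = -Q\<close>, where \<open>theta(w; Q)\<close> has zeros. With the
  reflection symmetry and the known coefficient of index 4, this is a linear
  system of two equations for the two unknown coefficients. By \<open>theta_mult\<close>, its determinant is
  \<open>theta(-Q\<^sup>2; Q\<^sup>5) theta(-Q; Q\<^sup>5)\<close>, and the numerators in Cramer's rule are the squares of the two
  factors times this product.\<close>
lemma quint_coeff_0_1:
  assumes Q: "norm Q < 1" "Q \<noteq> 0"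
  shows "quint_coeff Q 0 = (theta (- (Q ^ 2)) (Q ^ 5))\<^sup>2"
    and "quint_coeff Q 1 = (theta (- Q) (Q ^ 5))\<^sup>2"
proof -
  define th where "th = (\<lambda>k. theta (Q ^ k) (Q ^ 10))"
  define A B where "A = theta (- (Q ^ 2)) (Q ^ 5)" and "B = theta (- Q) (Q ^ 5)"
  have Q5: "norm (Q ^ 5) < 1"
    using Q by (auto simp: norm_power power_less_one_iff)
  have sym: "th (10 - k) = th k" if "k \<le> 10" for k
    unfolding th_def by (rule theta_symmetric_power(1)[OF Q]) (use that in auto)
  have shift: "th (10 + k) = th k / Q ^ k" for k
    unfolding th_def by (rule theta_shift_power(1)[OF Q]) auto
  have syms: "th 6 = th 4" "th 7 = th 3" "th 8 = th 2" "th 9 = th 1"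
    using sym[of 4] sym[of 3] sym[of 2] sym[of 1] by simp_all
  have shifts: "th 10 = th 0" "th 11 = th 1 / Q" "th 13 = th 3 / Q ^ 3" "th 15 = th 5 / Q ^ 5"
    using shift[of 0] shift[of 1] shift[of 3] shift[of 5] by simp_all
  have G: "quint_coeff Q 2 = - quint_coeff Q 1" "quint_coeff Q 3 = - quint_coeff Q 0"
    using quint_coeff_reflect[of Q 1] quint_coeff_reflect[of Q 0] by simp_all
  have G4: "quint_coeff Q 4 = - 2 * Q * (A * B)"
    using quint_coeff_4[OF Q] theta_product_5[OF Q] by (simp add: A_def B_def)

  have zero: "theta (-1) Q = 0" "theta (- Q) Q = 0"
    using theta_minus_one[OF Q] theta_shift[OF Q, of "-1"] by simp_all
  have "0 = (\<Sum>c<5. (-1) ^ c * quint_coeff Q (int c) * th (2 * c + 2))"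
    using theta_triple_dissection[OF Q, of "-1"] zero by (simp add: th_def)
  then have "2 * (quint_coeff Q 0 * th 2 - quint_coeff Q 1 * th 4) = 2 * (Q * (A * B) * th 0)"
    unfolding sum_lessThan_5
    by (simp add: G G4 syms shifts algebra_simps del: One_nat_def add_2_eq_Suc add_2_eq_Suc')
  then have E1: "quint_coeff Q 0 * th 2 - quint_coeff Q 1 * th 4 = Q * (A * B) * th 0"
    by (simp only: mult_cancel_left) simp
  have "(- ((- Q) ^ 5 * Q ^ (2 * c + 2))) = Q ^ (2 * c + 7)" for c
    by (simp add: power_add[symmetric] del: power_Suc) (simp add: power_add eval_nat_numeral)
  then have "0 = (\<Sum>c<5. (- Q) ^ c * quint_coeff Q (int c) * th (2 * c + 7))"
    using theta_triple_dissection[OF Q, of "- Q"] zero Q by (simp add: th_def del: power_Suc)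
  then have "0 = quint_coeff Q 0 * th 7 - Q * quint_coeff Q 1 * th 9 + Q ^ 2 * quint_coeff Q 2 * th 11
      - Q ^ 3 * quint_coeff Q 3 * th 13 + Q ^ 4 * quint_coeff Q 4 * th 15"
    unfolding sum_lessThan_5 by simp
  moreover have Q5_eq: "Q ^ 5 = Q ^ 4 * Q"
    by (simp add: eval_nat_numeral)
  moreover have "Q ^ 2 * quint_coeff Q 2 * th 11 = - (Q * quint_coeff Q 1 * th 1)"
    "Q ^ 3 * quint_coeff Q 3 * th 13 = - (quint_coeff Q 0 * th 3)"
    "Q ^ 4 * quint_coeff Q 4 * th 15 = - 2 * (A * B * th 5)"
    unfolding G G4 shifts using Q Q5_eq by (simp_all add: power2_eq_square)
  ultimately have "2 * (quint_coeff Q 0 * th 3 - Q * quint_coeff Q 1 * th 1) = 2 * (A * B * th 5)"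
    by (simp add: syms algebra_simps)
  then have E2: "quint_coeff Q 0 * th 3 - Q * quint_coeff Q 1 * th 1 = A * B * th 5"
    by (simp only: mult_cancel_left) simp
  have R: "(Q ^ 5)\<^sup>2 = Q ^ 10"
    by (simp flip: power_mult)
  have pw: "Q ^ 2 * Q ^ 2 = Q ^ 4" "Q ^ 5 * Q ^ 2 * Q ^ 2 = Q ^ 9" "Q * Q = Q ^ 2" "Q ^ 5 * Q * Q = Q ^ 7"
     "Q ^ 2 * Q = Q ^ 3" "Q ^ 5 * Q ^ 2 * Q = Q ^ 8" "Q ^ 5 * Q ^ 2 / Q = Q ^ 6" "Q ^ 2 / Q = Q" "Q ^ 7 / Q ^ 2 = Q ^ 5" "Q ^ 7 / Q = Q ^ 6" "Q ^ 7 * Q = Q ^ 8"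
    using Q by (simp_all add: eval_nat_numeral)
  have A2: "A\<^sup>2 = th 4 * th 5 - Q ^ 2 * (th 1 * th 0)"
    using theta_mult[OF Q5, of "- (Q ^ 2)" "- (Q ^ 2)"] Q
    by (simp add: A_def power2_eq_square[of "theta _ _"] R pw syms(4)[unfolded th_def] th_def)
  have B2: "B\<^sup>2 = th 2 * th 5 - Q * (th 3 * th 0)"
    using theta_mult[OF Q5, of "- Q" "- Q"] Q
    by (simp add: B_def power2_eq_square[of "theta _ _"] R pw syms(2)[unfolded th_def] th_def)
  have AB: "A * B = th 3 * th 4 - Q * (th 2 * th 1)"
    using theta_mult[OF Q5, of "- (Q ^ 2)" "- Q"] Q
    by (simp add: A_def B_def R pw syms(1,3)[unfolded th_def] th_def)
  have AB0: "A * B \<noteq> 0"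
  proof -
    have "qpoch_inf Q Q \<noteq> 0" "qpoch_inf (Q ^ 5) (Q ^ 5) \<noteq> 0"
      using Q Q5 by (simp_all add: qpoch_inf_nonzero)
    moreover have "theta (- (Q ^ 5)) (Q ^ 15) = qpoch_inf (Q ^ 5) (Q ^ 5)"
      using theta_pentagonal[of "Q ^ 5"] Q Q5 by (simp flip: power_mult)
    ultimately show ?thesis
      unfolding A_def B_def theta_product_5[OF Q, symmetric] theta_pentagonal[OF Q] by simp
  qed
  \<comment> \<open>Cramer's rule; \<open>A B\<close> is the determinant.\<close>
  have "quint_coeff Q 0 * (A * B) =
      (quint_coeff Q 0 * th 3 - Q * quint_coeff Q 1 * th 1) * th 4 - Q * th 1 * (quint_coeff Q 0 * th 2 - quint_coeff Q 1 * th 4)"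
    unfolding AB by (simp add: algebra_simps)
  also have "\<dots> = A\<^sup>2 * (A * B)"
    unfolding E1 E2 A2 by (simp add: algebra_simps power2_eq_square)
  finally show "quint_coeff Q 0 = (theta (- (Q ^ 2)) (Q ^ 5))\<^sup>2"
    using AB0 by (simp add: A_def)
  have "quint_coeff Q 1 * (A * B) =
      (quint_coeff Q 0 * th 3 - Q * quint_coeff Q 1 * th 1) * th 2 - th 3 * (quint_coeff Q 0 * th 2 - quint_coeff Q 1 * th 4)"
    unfolding AB by (simp add: algebra_simps)
  also have "\<dots> = B\<^sup>2 * (A * B)"
    unfolding E1 E2 B2 by (simp add: algebra_simps power2_eq_square)
  finally show "quint_coeff Q 1 = (theta (- Q) (Q ^ 5))\<^sup>2"
    using AB0 by (simp add: B_def)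
qed

text \<open>The two Rogers-Ramanujan functions in product form.\<close>
definition rr_G :: "complex \<Rightarrow> complex" where
  "rr_G q = inverse (qpochs_inf [q, q ^ 4] (q ^ 5))"

definition rr_H :: "complex \<Rightarrow> complex" where
  "rr_H q = inverse (qpochs_inf [q ^ 2, q ^ 3] (q ^ 5))"

text \<open>The expansion at \<open>w = q\<^sup>2\<close> and \<open>Q = q\<^sup>5\<close>, divided by \<open>(Q; Q)\<^sup>2 (Q\<^sup>2; Q\<^sup>2)\<close>. The term of
  index 3 carries the factor \<open>theta(-Q\<^bsup>10\<^esup>; Q\<^bsup>10\<^esup>) = 0\<close>, which is why the exponents
  congruent to 1 modulo 5 are absent.\<close>
lemma h1_gf_dissection:
  assumes "norm q < 1"
  shows "h1_gf q = (rr_G (q ^ 5))\<^sup>2 * rr_G (q ^ 10) + q ^ 2 * ((rr_H (q ^ 5))\<^sup>2 * rr_G (q ^ 10))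
    + q ^ 3 * (2 * (rr_G (q ^ 5) * rr_H (q ^ 5) * rr_H (q ^ 10))) - q ^ 4 * ((rr_H (q ^ 5))\<^sup>2 * rr_H (q ^ 10))"
proof (cases "q = 0")
  case True
  then show ?thesis
    by (simp add: h1_gf_def rr_G_def qpochs_inf_def)
next
  case False
  define Q where "Q = q ^ 5"
  define \<alpha> \<beta> where "\<alpha> = qpochs_inf [Q, Q ^ 4] (Q ^ 5)" and "\<beta> = qpochs_inf [Q ^ 2, Q ^ 3] (Q ^ 5)"
  define \<gamma> \<delta> where "\<gamma> = qpochs_inf [Q ^ 2, Q ^ 8] (Q ^ 10)" and "\<delta> = qpochs_inf [Q ^ 4, Q ^ 6] (Q ^ 10)"
  have rr: "rr_G (q ^ 5) = inverse \<alpha>" "rr_H (q ^ 5) = inverse \<beta>" "rr_G (q ^ 10) = inverse \<gamma>" "rr_H (q ^ 10) = inverse \<delta>"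
    by (simp_all add: rr_G_def rr_H_def \<alpha>_def \<beta>_def \<gamma>_def \<delta>_def Q_def flip: power_mult)
  have q: "norm q < 1" "q \<noteq> 0"
    using assms False by auto
  have Q: "norm Q < 1" "Q \<noteq> 0"
    using q by (auto simp: Q_def norm_power power_less_one_iff)
  have Q2: "norm (Q ^ 2) < 1" and Q10: "norm (Q ^ 10) < 1"
    using Q by (auto simp: norm_power power_less_one_iff)
  define e e' where "e = qpoch_inf (Q ^ 5) (Q ^ 5)" and "e' = qpoch_inf (Q ^ 10) (Q ^ 10)"
  have qQ: "qpoch_inf Q Q = \<alpha> * \<beta> * e"
    using qpoch_inf_5[OF Q(1)] by (simp add: \<alpha>_def \<beta>_def e_def)
  have qQ2: "qpoch_inf (Q ^ 2) (Q ^ 2) = \<gamma> * \<delta> * e'"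
    using qpoch_inf_5[OF Q2] by (simp add: \<gamma>_def \<delta>_def e'_def flip: power_mult)
  have nz: "\<alpha> \<noteq> 0" "\<beta> \<noteq> 0" "\<gamma> \<noteq> 0" "\<delta> \<noteq> 0" "e \<noteq> 0" "e' \<noteq> 0"
    using qpoch_inf_nonzero[OF Q(1) Q(1)] qpoch_inf_nonzero[OF Q2 Q2] unfolding qQ qQ2 by auto
  have thA: "theta (- (Q ^ 2)) (Q ^ 5) = \<beta> * e" and thB: "theta (- Q) (Q ^ 5) = \<alpha> * e"
    using theta_neg_power[OF Q, of 2 5] theta_neg_power[OF Q, of 1 5] by (simp_all add: \<alpha>_def \<beta>_def e_def)
  have th2: "theta (- (Q ^ 2)) (Q ^ 10) = \<gamma> * e'" and th4: "theta (- (Q ^ 4)) (Q ^ 10) = \<delta> * e'"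
    using theta_neg_power[OF Q, of 2 10] theta_neg_power[OF Q, of 4 10] by (simp_all add: \<gamma>_def \<delta>_def e'_def)
  have th6: "theta (- (Q ^ 6)) (Q ^ 10) = \<delta> * e'" and th8: "theta (- (Q ^ 8)) (Q ^ 10) = \<gamma> * e'"
    using theta_symmetric_power(2)[OF Q, of 10 4] theta_symmetric_power(2)[OF Q, of 10 2] th2 th4 by simp_all
  have th10: "theta (- (Q ^ 10)) (Q ^ 10) = 0" and th12: "theta (- (Q ^ 12)) (Q ^ 10) = - \<gamma> * e' / Q ^ 2"
    using theta_shift_power(2)[OF Q, of 10 0] theta_shift_power(2)[OF Q, of 10 2] theta_minus_one[of "Q ^ 10"] Q Q10 th2
    by simp_all
  have G: "quint_coeff Q 0 = (\<beta> * e)\<^sup>2" "quint_coeff Q 1 = (\<alpha> * e)\<^sup>2" "quint_coeff Q 2 = - (\<alpha> * e)\<^sup>2"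
      "quint_coeff Q 3 = - (\<beta> * e)\<^sup>2" "quint_coeff Q 4 = - 2 * Q * (\<alpha> * \<beta> * e\<^sup>2)"
    using quint_coeff_0_1[OF Q, unfolded thA thB] quint_coeff_reflect[of Q 1] quint_coeff_reflect[of Q 0]
      quint_coeff_4[OF Q, unfolded theta_product_5[OF Q] thA thB] by (simp_all add: power2_eq_square[of e] mult_ac)
  have "(q ^ 2) ^ 5 * Q ^ (2 * c + 2) = Q ^ (2 * c + 4)" for c
    by (simp add: Q_def algebra_simps flip: power_mult power_add)
  then have "(theta (q ^ 2) Q)\<^sup>2 * theta (- (q ^ 2)) (Q ^ 2) =
    (\<Sum>c<5. (q ^ 2) ^ c * quint_coeff Q (int c) * theta (- (Q ^ (2 * c + 4))) (Q ^ 10))"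
    using theta_triple_dissection[OF Q, of "q ^ 2"] q by (simp del: power_Suc)
  also have "\<dots> = (\<beta> * e)\<^sup>2 * (\<delta> * e') + q ^ 2 * ((\<alpha> * e)\<^sup>2 * (\<delta> * e')) - q ^ 4 * ((\<alpha> * e)\<^sup>2 * (\<gamma> * e'))
      + q ^ 8 / Q * (2 * (\<alpha> * \<beta> * e\<^sup>2) * (\<gamma> * e'))"
    using Q unfolding sum_lessThan_5 by (simp add: G th4 th6 th8 th10 th12 power2_eq_square[of Q] del: One_nat_def add_2_eq_Suc add_2_eq_Suc' flip: power_mult)
  also have "q ^ 8 / Q = q ^ 3"
    using q by (simp add: Q_def eval_nat_numeral)
  finally have eq: "(theta (q ^ 2) Q)\<^sup>2 * theta (- (q ^ 2)) (Q ^ 2) =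
     (\<beta> * e)\<^sup>2 * (\<delta> * e') + q ^ 2 * ((\<alpha> * e)\<^sup>2 * (\<delta> * e')) - q ^ 4 * ((\<alpha> * e)\<^sup>2 * (\<gamma> * e'))
      + q ^ 3 * (2 * (\<alpha> * \<beta> * e\<^sup>2) * (\<gamma> * e'))" .
  have "theta (q ^ 2) Q = qpochs_inf [- (q ^ 2), - (q ^ 3)] (q ^ 5) * (\<alpha> * \<beta> * e)"
  proof -
    have "Q / q ^ 2 = q ^ 3"
      using q by (simp add: Q_def eval_nat_numeral)
    then show ?thesis
      using Q q by (subst jacobi_triple_product) (auto simp: qpochs_inf_def qQ [symmetric] Q_def)
  qed
  moreover have "theta (- (q ^ 2)) (Q ^ 2) = qpochs_inf [q ^ 2, q ^ 8] (q ^ 10) * (\<gamma> * \<delta> * e')"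
    using theta_neg_power[OF q, of 2 10] unfolding qQ2 [symmetric] by (simp add: Q_def flip: power_mult)
  ultimately have "h1_gf q * ((\<alpha> * \<beta> * e)\<^sup>2 * (\<gamma> * \<delta> * e')) =
     (\<beta> * e)\<^sup>2 * (\<delta> * e') + q ^ 2 * ((\<alpha> * e)\<^sup>2 * (\<delta> * e')) - q ^ 4 * ((\<alpha> * e)\<^sup>2 * (\<gamma> * e'))
      + q ^ 3 * (2 * (\<alpha> * \<beta> * e\<^sup>2) * (\<gamma> * e'))"
    using eq by (simp add: h1_gf_def power_mult_distrib mult_ac)
  also have "\<dots> = ((inverse \<alpha>)\<^sup>2 * inverse \<gamma> + q ^ 2 * ((inverse \<beta>)\<^sup>2 * inverse \<gamma>)
    + q ^ 3 * (2 * (inverse \<alpha> * inverse \<beta> * inverse \<delta>)) - q ^ 4 * ((inverse \<beta>)\<^sup>2 * inverse \<delta>))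
      * ((\<alpha> * \<beta> * e)\<^sup>2 * (\<gamma> * \<delta> * e'))"
    using nz by (simp add: field_simps power2_eq_square)
  finally show ?thesis
    unfolding rr using nz by simp
qed

section \<open>Power series with nonnegative coefficients\<close>

text \<open>The constant coefficient is normalised to 1 so that multiplying by such a series cannot decrease
  any coefficient of a nonnegative series (\<open>expansion_mult_ge\<close>).\<close>
definition nonneg_expansion :: "(complex \<Rightarrow> complex) \<Rightarrow> bool" where
  "nonneg_expansion f \<longleftrightarrow>
     (\<exists>F. f has_fps_expansion F \<and> fps_nth F 0 = 1 \<and> (\<forall>n. fps_nth F n \<in> \<real>\<^sub>\<ge>\<^sub>0))"

lemma sum_in_nonneg_Reals:
  "(\<And>i. i \<in> I \<Longrightarrow> f i \<in> \<real>\<^sub>\<ge>\<^sub>0) \<Longrightarrow> (\<Sum>i\<in>I. f i) \<in> (\<real>\<^sub>\<ge>\<^sub>0 :: complex set)"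
  by (induction I rule: infinite_finite_induct) auto

lemma nonneg_expansion_mult:
  assumes "nonneg_expansion f" "nonneg_expansion g"
  shows "nonneg_expansion (\<lambda>q. f q * g q)"
proof -
  from assms obtain F G where F: "f has_fps_expansion F" "fps_nth F 0 = 1" "\<And>n. fps_nth F n \<in> \<real>\<^sub>\<ge>\<^sub>0"
    and G: "g has_fps_expansion G" "fps_nth G 0 = 1" "\<And>n. fps_nth G n \<in> \<real>\<^sub>\<ge>\<^sub>0"
    unfolding nonneg_expansion_def by blast
  have "fps_nth (F * G) n \<in> \<real>\<^sub>\<ge>\<^sub>0" for n
    unfolding fps_mult_nth by (intro sum_in_nonneg_Reals nonneg_Reals_mult_I F G)
  moreover have "fps_nth (F * G) 0 = 1"
    using F G by simp
  ultimately show ?thesis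
    unfolding nonneg_expansion_def using has_fps_expansion_mult[OF F(1) G(1)] by blast
qed

lemma nonneg_expansion_prod:
  "(\<And>i. i \<in> I \<Longrightarrow> nonneg_expansion (f i)) \<Longrightarrow> nonneg_expansion (\<lambda>q. \<Prod>i\<in>I. f i q)"
proof (induction I rule: infinite_finite_induct)
  case (insert i I)
  then show ?case
    using nonneg_expansion_mult[of "f i" "\<lambda>q. \<Prod>i\<in>I. f i q"] by simp
qed (auto simp: nonneg_expansion_def intro!: exI[of _ 1])

lemma inverse_one_minus_X_power_nth:
  assumes "k > 0"
  shows "fps_nth (inverse (1 - fps_X ^ k) :: complex fps) n = (if k dvd n then 1 else 0)"
proof -
  let ?F = "Abs_fps (\<lambda>n. if k dvd n then 1 else 0 :: complex)"
  have "(1 - fps_X ^ k) * ?F = 1"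
  proof (rule fps_ext)
    fix n
    show "fps_nth ((1 - fps_X ^ k) * ?F) n = fps_nth 1 n"
      using assms dvd_imp_le[of k n] dvd_minus_self[of k n]
      by (auto simp: algebra_simps fps_X_power_mult_nth)
  qed
  then have "inverse (1 - fps_X ^ k) = ?F"
    by (rule fps_inverse_unique)
  then show ?thesis by simp
qed

lemma has_fps_expansion_inverse_one_minus_power:
  assumes "k > 0"
  shows "(\<lambda>q. inverse (1 - q ^ k)) has_fps_expansion inverse (1 - fps_X ^ k :: complex fps)"
  using assms by (intro has_fps_expansion_inverse has_fps_expansion_diff has_fps_expansion_1 has_fps_expansion_fps_X_power)
    (auto simp: fps_X_power_nth)

lemma nonneg_expansion_inverse_one_minus_power:
  assumes "k > 0"
  shows "nonneg_expansion (\<lambda>q. inverse (1 - q ^ k))"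
  unfolding nonneg_expansion_def
  by (rule exI[of _ "inverse (1 - fps_X ^ k)"])
     (use assms in \<open>simp add: has_fps_expansion_inverse_one_minus_power inverse_one_minus_X_power_nth\<close>)

text \<open>For \<open>norm q \<le> 1/2\<close> the \<open>n\<close>-th factor differs from 1 by at most \<open>(1/2)\<^sup>n\<close>, so the partial
  products converge uniformly; the limit is identified pointwise. Uniform convergence near 0
  passes to the Taylor coefficients at 0.\<close>
lemma uniform_limit_inverse_qpoch:
  assumes m: "m > 0" and k: "k > 0"
  shows "uniform_limit (cball 0 (1 / 2)) (\<lambda>n q. \<Prod>i<n. inverse (1 - q ^ (m + k * i)))
           (\<lambda>q. inverse (qpoch_inf (q ^ m) (q ^ k))) sequentially"
proof -
  have "uniformly_convergent_on (cball 0 (1 / 2 :: real)) (\<lambda>n (q :: complex). \<Prod>i<n. inverse (1 - q ^ (m + k * i)))"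
  proof (rule uniformly_convergent_on_prod')
    show "uniformly_convergent_on (cball 0 (1 / 2)) (\<lambda>N (q :: complex). \<Sum>n<N. norm (inverse (1 - q ^ (m + k * n)) - 1))"
    proof (rule Weierstrass_m_test')
      fix n and q :: complex
      assume "q \<in> cball 0 (1 / 2)"
      then have q: "norm q \<le> 1 / 2" by simp
      define u where "u = q ^ (m + k * n)"
      have "Suc n \<le> m + k * n"
        using m k by (cases m; cases k) auto
      then have "norm u \<le> (1 / 2) ^ Suc n"
        unfolding u_def norm_power
        by (intro order_trans[OF power_mono[OF q] power_decreasing]) auto
      then have u: "norm u \<le> 1 / 2 * (1 / 2) ^ n" "norm u \<le> 1 / 2"
        using power_le_one[of "1 / 2 :: real" n] by simp_all
      then have "1 / 2 \<le> norm (1 - u)"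
        using norm_triangle_ineq2[of 1 u] by simp
      then have nz: "1 - u \<noteq> 0" "norm (inverse (1 - u)) \<le> 2"
        using le_imp_inverse_le[of "1 / 2" "norm (1 - u)"] by (auto simp: norm_inverse)
      have "inverse (1 - u) - 1 = u * inverse (1 - u)"
        using nz(1) by (simp add: field_simps)
      then have "norm (inverse (1 - u) - 1) \<le> (1 / 2 * (1 / 2) ^ n) * 2"
        using mult_mono[OF u(1) nz(2)] by (simp add: norm_mult)
      then show "norm (norm (inverse (1 - q ^ (m + k * n)) - 1)) \<le> (1 / 2) ^ n"
        by (simp add: u_def)
    qed (simp add: summable_geometric)
    fix n
    show "continuous_on (cball 0 (1 / 2)) (\<lambda>q :: complex. inverse (1 - q ^ (m + k * n)))"
    proof (intro continuous_intros ballI)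
      fix q :: complex assume "q \<in> cball 0 (1 / 2)"
      then have "norm (q ^ (m + k * n)) < 1"
        using m by (simp add: norm_power power_less_one_iff)
      then show "1 - q ^ (m + k * n) \<noteq> 0" by auto
    qed
  qed auto
  then obtain g where g: "uniform_limit (cball 0 (1 / 2)) (\<lambda>n (q :: complex). \<Prod>i<n. inverse (1 - q ^ (m + k * i))) g sequentially"
    by (auto simp: uniformly_convergent_on_def)
  have "g q = inverse (qpoch_inf (q ^ m) (q ^ k))" if q: "q \<in> cball 0 (1 / 2)" for q
  proof -
    have norms: "norm (q ^ m) < 1" "norm (q ^ k) < 1"
      using q m k by (auto simp: norm_power power_less_one_iff)
    then have "(\<lambda>n. inverse (\<Prod>i<n. 1 - q ^ m * (q ^ k) ^ i)) \<longlonglongrightarrow> inverse (qpoch_inf (q ^ m) (q ^ k))"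
      by (intro tendsto_inverse qpoch_lim qpoch_inf_nonzero)
    then have "(\<lambda>n. \<Prod>i<n. inverse (1 - q ^ (m + k * i))) \<longlonglongrightarrow> inverse (qpoch_inf (q ^ m) (q ^ k))"
      by (simp add: power_add power_mult prod_inversef[unfolded o_def, symmetric])
    with tendsto_uniform_limitI[OF g q] show ?thesis
      by (rule LIMSEQ_unique)
  qed
  then show ?thesis
    using g by (subst uniform_limit_cong'[where h = _ and i = g]) auto
qed

text \<open>The partial products are finite products of geometric series. Their Taylor coefficients are
  nonnegative and converge to those of the infinite product, and the nonnegative reals are closed.\<close>
lemma nonneg_expansion_inverse_qpoch:
  assumes m: "m > 0" and k: "k > 0"
  shows "nonneg_expansion (\<lambda>q. inverse (qpoch_inf (q ^ m) (q ^ k)))"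
proof -
  define f where "f = (\<lambda>n (q :: complex). \<Prod>i<n. inverse (1 - q ^ (m + k * i)))"
  define g where "g = (\<lambda>q. inverse (qpoch_inf (q ^ m) (q ^ k)))"
  have norms: "norm (q ^ m) < 1" "norm (q ^ k) < 1" if "q \<in> ball 0 1" for q :: complex
    using that m k by (auto simp: norm_power power_less_one_iff)
  have lim: "(\<lambda>N. (deriv ^^ n) (f N) 0) \<longlonglongrightarrow> (deriv ^^ n) g 0" for n
  proof (rule higher_deriv_complex_uniform_limit)
    show "uniform_limit (ball 0 (1 / 2)) f g sequentially"
      unfolding f_def g_def by (rule uniform_limit_on_subset[OF uniform_limit_inverse_qpoch[OF m k]]) auto
    show "eventually (\<lambda>n. f n holomorphic_on ball 0 (1 / 2)) sequentially"
    proof (intro always_eventually allI)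
      fix N
      have "1 - q ^ (m + k * i) \<noteq> 0" if "q \<in> ball 0 (1 / 2)" for q :: complex and i
      proof -
        have "norm (q ^ (m + k * i)) < 1"
          using that m by (simp add: norm_power power_less_one_iff)
        then show ?thesis by auto
      qed
      then show "f N holomorphic_on ball 0 (1 / 2)"
        unfolding f_def by (intro holomorphic_intros) auto
    qed
  qed auto
  have "g holomorphic_on ball 0 1"
    unfolding g_def using qpoch_holo[of 1 k m] k qpoch_inf_nonzero norms
    by (intro holomorphic_intros) auto
  then have exp: "g has_fps_expansion fps_expansion g 0"
    by (intro has_fps_expansion_fps_expansion[of "ball 0 1"]) auto
  have nn: "fps_nth (fps_expansion g 0) n \<in> \<real>\<^sub>\<ge>\<^sub>0" for n
  proof -
    have "(deriv ^^ n) (f N) 0 \<in> \<real>\<^sub>\<ge>\<^sub>0" for N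
    proof -
      have "nonneg_expansion (f N)"
        unfolding f_def using m by (intro nonneg_expansion_prod nonneg_expansion_inverse_one_minus_power) auto
      then obtain F where F: "f N has_fps_expansion F" "fps_nth F n \<in> \<real>\<^sub>\<ge>\<^sub>0"
        by (auto simp: nonneg_expansion_def)
      from fps_nth_fps_expansion[OF F(1), of n] have "(deriv ^^ n) (f N) 0 = of_nat (fact n) * fps_nth F n"
        by simp
      then show ?thesis
        using nonneg_Reals_mult_I[OF nonneg_Reals_of_nat_I F(2)] by (simp only:)
    qed
    then have "(deriv ^^ n) g 0 \<in> \<real>\<^sub>\<ge>\<^sub>0"
      by (intro closed_sequentially[OF closed_nonneg_Reals_complex _ lim])
    then show ?thesis
      unfolding fps_expansion_def using nonneg_Reals_divide_I[OF _ nonneg_Reals_of_nat_I[of "fact n"]] by simp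
  qed
  have "fps_nth (fps_expansion g 0) 0 = g 0"
    by (simp add: fps_expansion_def)
  also have "g 0 = 1"
    using m by (simp add: g_def zero_power)
  finally show ?thesis
    using exp nn unfolding nonneg_expansion_def g_def by blast
qed

lemma nonneg_expansion_compose_power:
  assumes "nonneg_expansion f" "k > 0"
  shows "nonneg_expansion (\<lambda>q. f (q ^ k))"
proof -
  from assms obtain F where F: "f has_fps_expansion F" "fps_nth F 0 = 1" "\<And>n. fps_nth F n \<in> \<real>\<^sub>\<ge>\<^sub>0"
    unfolding nonneg_expansion_def by blast
  have "(f \<circ> (\<lambda>q. q ^ k)) has_fps_expansion (F oo fps_X ^ k)"
    by (intro has_fps_expansion_compose F has_fps_expansion_fps_X_power) (use assms in simp)
  then show ?thesis
    unfolding nonneg_expansion_def using F(2,3) assms(2)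
    by (intro exI[of _ "F oo fps_X ^ k"]) (simp add: o_def fps_nth_compose_X_power)
qed

lemma expansion_mult_ge:
  assumes f: "f has_fps_expansion F" "\<And>n. fps_nth F n \<in> \<real>\<^sub>\<ge>\<^sub>0" and g: "nonneg_expansion g"
  shows "\<exists>H. (\<lambda>q. f q * g q) has_fps_expansion H \<and> (\<forall>n. fps_nth H n - fps_nth F n \<in> \<real>\<^sub>\<ge>\<^sub>0)"
proof -
  from g obtain G where G: "g has_fps_expansion G" "fps_nth G 0 = 1" "\<And>n. fps_nth G n \<in> \<real>\<^sub>\<ge>\<^sub>0"
    unfolding nonneg_expansion_def by blast
  have "fps_nth (F * G) n - fps_nth F n \<in> \<real>\<^sub>\<ge>\<^sub>0" for n
  proof -
    have "fps_nth (F * G) n = fps_nth F n + (\<Sum>i<n. fps_nth F i * fps_nth G (n - i))"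
      by (simp add: fps_mult_nth atLeast0AtMost G(2) flip: lessThan_Suc_atMost)
    then show ?thesis
      by (simp add: sum_in_nonneg_Reals f(2) G(3))
  qed
  then show ?thesis
    using has_fps_expansion_mult[OF f(1) G(1)] by blast
qed

section \<open>Signs of the coefficients\<close>

lemma nonneg_expansion_rr_G: "nonneg_expansion rr_G"
  using nonneg_expansion_mult[OF nonneg_expansion_inverse_qpoch[of 1 5] nonneg_expansion_inverse_qpoch[of 4 5]]
  by (simp add: rr_G_def[abs_def] qpochs_inf_def)

lemma nonneg_expansion_rr_H: "nonneg_expansion rr_H"
  using nonneg_expansion_mult[OF nonneg_expansion_inverse_qpoch[of 2 5] nonneg_expansion_inverse_qpoch[of 3 5]]
  by (simp add: rr_H_def[abs_def] qpochs_inf_def)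

lemma eventually_unit_ball: "eventually (\<lambda>q :: complex. norm q < 1) (nhds 0)"
  using eventually_nhds_in_open[of "ball 0 1" "0 :: complex"] by simp

text \<open>The first factor of \<open>(q; q\<^sup>5)\<close> contributes a geometric series with all coefficients 1.\<close>
lemma rr_G_mult_coeffs:
  assumes g: "nonneg_expansion g"
  obtains F where "(\<lambda>q. rr_G q * g q) has_fps_expansion F" "\<And>n. Re (fps_nth F n) \<ge> 1"
proof -
  define r where "r = (\<lambda>q. inverse (qpoch_inf (q ^ 6) (q ^ 5)) * inverse (qpoch_inf (q ^ 4) (q ^ 5)) * g q)"
  have r: "nonneg_expansion r"
    unfolding r_def by (intro nonneg_expansion_mult nonneg_expansion_inverse_qpoch g) auto
  have geom: "fps_nth (inverse (1 - fps_X) :: complex fps) n = 1" for n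
    using inverse_one_minus_X_power_nth[of 1 n] by simp
  have exp: "(\<lambda>q. inverse (1 - q)) has_fps_expansion inverse (1 - fps_X :: complex fps)"
    using has_fps_expansion_inverse_one_minus_power[of 1] by simp
  obtain F where F: "(\<lambda>q. inverse (1 - q) * r q) has_fps_expansion F" "\<And>n. fps_nth F n - 1 \<in> \<real>\<^sub>\<ge>\<^sub>0"
    using expansion_mult_ge[OF exp _ r] unfolding geom by auto
  have ev: "eventually (\<lambda>q. inverse (1 - q) * r q = rr_G q * g q) (nhds 0)"
    using eventually_unit_ball
  proof eventually_elim
    case (elim q)
    then have "norm (q ^ 5) < 1"
      by (simp add: norm_power power_less_one_iff)
    from qpoch_inf_split_head[OF this, of q] show ?case
      by (simp add: rr_G_def r_def qpochs_inf_def flip: power_Suc)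
  qed
  have "(\<lambda>q. rr_G q * g q) has_fps_expansion F"
    using has_fps_expansion_cong[OF ev refl] F(1) by (rule iffD1)
  moreover have "Re (fps_nth F n) \<ge> 1" for n
    using F(2)[of n] by (simp add: complex_nonneg_Reals_iff)
  ultimately show ?thesis
    by (rule that)
qed

text \<open>The first factors of \<open>(q\<^sup>2; q\<^sup>5)\<close> and \<open>(q\<^sup>3; q\<^sup>5)\<close> contribute \<open>1/((1 - q\<^sup>2)(1 - q\<^sup>3))\<close>, whose \<open>n\<close>-th
  coefficient counts the representations of \<open>n\<close> as a sum of twos and threes; only \<open>n = 1\<close> has none.\<close>
lemma rr_H_mult_coeffs:
  assumes g: "nonneg_expansion g"
  obtains F where "(\<lambda>q. rr_H q * g q) has_fps_expansion F" "\<And>n. n \<noteq> 1 \<Longrightarrow> Re (fps_nth F n) \<ge> 1"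
proof -
  define r where "r = (\<lambda>q. inverse (qpoch_inf (q ^ 7) (q ^ 5)) * inverse (qpoch_inf (q ^ 8) (q ^ 5)) * g q)"
  have r: "nonneg_expansion r"
    unfolding r_def by (intro nonneg_expansion_mult nonneg_expansion_inverse_qpoch g) auto
  define S :: "complex fps" where "S = inverse (1 - fps_X ^ 2) * inverse (1 - fps_X ^ 3)"
  have S_nth: "fps_nth S n = (\<Sum>i=0..n. (if 2 dvd i then 1 else 0) * (if 3 dvd n - i then 1 else 0))" for n
    by (simp add: S_def fps_mult_nth inverse_one_minus_X_power_nth)
  have S_nonneg: "fps_nth S n \<in> \<real>\<^sub>\<ge>\<^sub>0" for n
    unfolding S_nth by (intro sum_in_nonneg_Reals) auto
  have S_ge: "fps_nth S n - 1 \<in> \<real>\<^sub>\<ge>\<^sub>0" if "n \<noteq> 1" for n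
  proof -
    \<comment> \<open>The total of the twos in one such representation: an odd \<open>n > 1\<close> uses a single three.\<close>
    define k where "k = (if even n then n else n - 3)"
    have k: "k \<in> {0..n}" "2 dvd k" "3 dvd n - k"
      using that unfolding k_def by (auto, presburger+)
    then have "fps_nth S n - 1 = (\<Sum>i\<in>{0..n} - {k}. (if 2 dvd i then 1 else 0) * (if 3 dvd n - i then 1 else 0))"
      unfolding S_nth by (subst sum.remove[of _ k]) auto
    then show ?thesis
      by (auto intro!: sum_in_nonneg_Reals)
  qed
  have exp: "(\<lambda>q. inverse (1 - q ^ 2) * inverse (1 - q ^ 3)) has_fps_expansion S"
    unfolding S_def by (intro has_fps_expansion_mult has_fps_expansion_inverse_one_minus_power) auto
  obtain F where F: "(\<lambda>q. inverse (1 - q ^ 2) * inverse (1 - q ^ 3) * r q) has_fps_expansion F"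
      "\<And>n. fps_nth F n - fps_nth S n \<in> \<real>\<^sub>\<ge>\<^sub>0"
    using expansion_mult_ge[OF exp S_nonneg r] by auto
  have ev: "eventually (\<lambda>q. inverse (1 - q ^ 2) * inverse (1 - q ^ 3) * r q = rr_H q * g q) (nhds 0)"
    using eventually_unit_ball
  proof eventually_elim
    case (elim q)
    then have "norm (q ^ 5) < 1"
      by (simp add: norm_power power_less_one_iff)
    from qpoch_inf_split_head[OF this, of "q ^ 2"] qpoch_inf_split_head[OF this, of "q ^ 3"] show ?case
      by (simp add: rr_H_def r_def qpochs_inf_def mult_ac flip: power_add)
  qed
  have "(\<lambda>q. rr_H q * g q) has_fps_expansion F"
    using has_fps_expansion_cong[OF ev refl] F(1) by (rule iffD1)
  moreover have "Re (fps_nth F n) \<ge> 1" if "n \<noteq> 1" for n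
    using F(2)[of n] S_ge[OF that] by (simp add: complex_nonneg_Reals_iff)
  ultimately show ?thesis
    by (rule that)
qed

theorem corollary1p4:
  fixes h1 :: "nat \<Rightarrow> real"
  assumes h1: "\<And>q :: complex. norm q < 1 \<Longrightarrow>
      (\<lambda>n. of_real (h1 n) * q ^ n) sums
        ((qpochs_inf [- (q ^ 2), - (q ^ 3)] (q ^ 5)) ^ 2 * qpochs_inf [q ^ 2, q ^ 8] (q ^ 10))"
  shows "\<forall>n :: nat.
      h1 (5 * n) > 0 \<and>
      (n \<noteq> 1 \<longrightarrow> h1 (5 * n + 2) > 0) \<and>
      h1 (5 * n + 3) > 0 \<and>
      (n \<noteq> 1 \<longrightarrow> h1 (5 * n + 4) < 0)"
proof -
  have G2: "nonneg_expansion (\<lambda>q. rr_G (q ^ 2))" and H2: "nonneg_expansion (\<lambda>q. rr_H (q ^ 2))"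
    by (intro nonneg_expansion_compose_power nonneg_expansion_rr_G nonneg_expansion_rr_H; simp)+
  obtain F0 where F0: "(\<lambda>q. rr_G q * (rr_G q * rr_G (q ^ 2))) has_fps_expansion F0"
      "\<And>n. Re (fps_nth F0 n) \<ge> 1"
    using rr_G_mult_coeffs[OF nonneg_expansion_mult[OF nonneg_expansion_rr_G G2]] by blast
  obtain F2 where F2: "(\<lambda>q. rr_H q * (rr_H q * rr_G (q ^ 2))) has_fps_expansion F2"
      "\<And>n. n \<noteq> 1 \<Longrightarrow> Re (fps_nth F2 n) \<ge> 1"
    using rr_H_mult_coeffs[OF nonneg_expansion_mult[OF nonneg_expansion_rr_H G2]] by blast
  obtain F3 where F3: "(\<lambda>q. rr_G q * (rr_H q * rr_H (q ^ 2))) has_fps_expansion F3"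
      "\<And>n. Re (fps_nth F3 n) \<ge> 1"
    using rr_G_mult_coeffs[OF nonneg_expansion_mult[OF nonneg_expansion_rr_H H2]] by blast
  obtain F4 where F4: "(\<lambda>q. rr_H q * (rr_H q * rr_H (q ^ 2))) has_fps_expansion F4"
      "\<And>n. n \<noteq> 1 \<Longrightarrow> Re (fps_nth F4 n) \<ge> 1"
    using rr_H_mult_coeffs[OF nonneg_expansion_mult[OF nonneg_expansion_rr_H H2]] by blast
  have comp: "(\<lambda>q. f (q ^ 5)) has_fps_expansion (F oo fps_X ^ 5)" if "f has_fps_expansion F"
    for f :: "complex \<Rightarrow> complex" and F
    using has_fps_expansion_compose[OF that has_fps_expansion_fps_X_power[of 5]] by (simp add: o_def)
  define K where "K = (F0 oo fps_X ^ 5) + fps_X ^ 2 * (F2 oo fps_X ^ 5) +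
    fps_X ^ 3 * (2 * (F3 oo fps_X ^ 5)) - fps_X ^ 4 * (F4 oo fps_X ^ 5)"
  have K: "(\<lambda>q. rr_G (q ^ 5) * (rr_G (q ^ 5) * rr_G ((q ^ 5) ^ 2)) +
      q ^ 2 * (rr_H (q ^ 5) * (rr_H (q ^ 5) * rr_G ((q ^ 5) ^ 2))) +
      q ^ 3 * (2 * (rr_G (q ^ 5) * (rr_H (q ^ 5) * rr_H ((q ^ 5) ^ 2)))) -
      q ^ 4 * (rr_H (q ^ 5) * (rr_H (q ^ 5) * rr_H ((q ^ 5) ^ 2)))) has_fps_expansion K"
    unfolding K_def
    by (intro has_fps_expansion_add has_fps_expansion_diff has_fps_expansion_mult has_fps_expansion_numeral
        has_fps_expansion_fps_X_power comp[OF F0(1)] comp[OF F2(1)] comp[OF F3(1)] comp[OF F4(1)])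
  have ev: "eventually (\<lambda>q. rr_G (q ^ 5) * (rr_G (q ^ 5) * rr_G ((q ^ 5) ^ 2)) +
      q ^ 2 * (rr_H (q ^ 5) * (rr_H (q ^ 5) * rr_G ((q ^ 5) ^ 2))) +
      q ^ 3 * (2 * (rr_G (q ^ 5) * (rr_H (q ^ 5) * rr_H ((q ^ 5) ^ 2)))) -
      q ^ 4 * (rr_H (q ^ 5) * (rr_H (q ^ 5) * rr_H ((q ^ 5) ^ 2))) = h1_gf q) (nhds 0)"
    using eventually_unit_ball
  proof eventually_elim
    case (elim q)
    have "(q ^ 5) ^ 2 = q ^ 10"
      by (simp flip: power_mult)
    then show ?case
      by (simp add: h1_gf_dissection[OF elim] power2_eq_square[of "_ (_ ^ 5)"] mult_ac)
  qed
  have "h1_gf has_fps_expansion K"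
    using has_fps_expansion_cong[OF ev refl] K by (rule iffD1)
  moreover have "h1_gf has_fps_expansion Abs_fps (\<lambda>n. of_real (h1 n))"
  proof (rule has_fps_expansionI)
    show "eventually (\<lambda>q. (\<lambda>n. fps_nth (Abs_fps (\<lambda>n. of_real (h1 n))) n * q ^ n) sums h1_gf q) (nhds 0)"
      using eventually_unit_ball by eventually_elim (simp add: h1_gf_def h1)
  qed
  ultimately have "K = Abs_fps (\<lambda>n. of_real (h1 n))"
    by (rule fps_expansion_unique_complex)
  then have h1_eq: "h1 n = Re (fps_nth K n)" for n
    by simp
  have e0: "h1 (5 * n) = Re (fps_nth F0 n)" for n
  proof -
    have "\<not> 5 dvd 5 * n - k \<or> 5 * n < k" if "0 < k" "k < 5" for k
      using that by presburger
    from this[of 2] this[of 3] this[of 4] show ?thesis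
      by (auto simp: h1_eq K_def fps_X_power_mult_nth fps_nth_compose_X_power numeral_fps_const)
  qed
  have e2: "h1 (5 * n + 2) = Re (fps_nth F2 n)" for n
  proof -
    have "\<not> 5 dvd 5 * n + 2" "\<not> 5 dvd 5 * n + 2 - 3 \<or> 5 * n + 2 < 3" "\<not> 5 dvd 5 * n + 2 - 4 \<or> 5 * n + 2 < 4"
      by presburger+
    then show ?thesis
      by (auto simp: h1_eq K_def fps_X_power_mult_nth fps_nth_compose_X_power numeral_fps_const)
  qed
  have e3: "h1 (5 * n + 3) = 2 * Re (fps_nth F3 n)" for n
  proof -
    have "\<not> 5 dvd 5 * n + 3" "\<not> 5 dvd 5 * n + 3 - 2" "\<not> 5 dvd 5 * n + 3 - 4 \<or> 5 * n + 3 < 4"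
      by presburger+
    then show ?thesis
      by (auto simp: h1_eq K_def fps_X_power_mult_nth fps_nth_compose_X_power numeral_fps_const)
  qed
  have e4: "h1 (5 * n + 4) = - Re (fps_nth F4 n)" for n
  proof -
    have "\<not> 5 dvd 5 * n + 4" "\<not> 5 dvd 5 * n + 4 - 2" "\<not> 5 dvd 5 * n + 4 - 3"
      by presburger+
    then show ?thesis
      by (auto simp: h1_eq K_def fps_X_power_mult_nth fps_nth_compose_X_power numeral_fps_const)
  qed
  show ?thesis
  proof (intro allI conjI impI)
    fix n
    show "h1 (5 * n) > 0"
      using e0[of n] F0(2)[of n] by linarith
    show "h1 (5 * n + 2) > 0" if "n \<noteq> 1"
      using e2[of n] F2(2)[OF that] by linarith
    show "h1 (5 * n + 3) > 0"
      using e3[of n] F3(2)[of n] by linarith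
    show "h1 (5 * n + 4) < 0" if "n \<noteq> 1"
      using e4[of n] F4(2)[OF that] by linarith
  qed
qed

end
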